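(* Let $\mathbf{Cat}$ be the category of small categories with its folk model structure, whose weak equivalences are the equivalences of categories and whose cofibrations are the functors injective on objects. Then the homotopy category $\mathrm{ho}(\mathbf{Cat})$ (the localization of $\mathbf{Cat}$ at the equivalences of categories) is not concrete, i.e. it admits no faithful functor to $\mathbf{Set}$.
   Context: A category $\mathbf{C}$ is concrete if it admits a faithful functor $\mathbf{C}\to\mathbf{Set}$. A model category $\mathcal{M}$ is called homotopy concrete if its homotopy category $\mathrm{ho}(\mathcal{M})=\mathcal{M}[\mathrm{wk}^{-1}]$ (localization at the weak equivalences) is concrete. *)

theory Defs
  imports "HOL-Library.Equipollence" "HOL-Library.FuncSet"
begin

section \<open>Categories, functors, equivalences\<close>

record ('o, 'a) cat =
  Obj :: "'o set"
  Arr :: "'a set"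
  Dom :: "'a \<Rightarrow> 'o"
  Cod :: "'a \<Rightarrow> 'o"
  Ide :: "'o \<Rightarrow> 'a"
  Comp :: "'a \<Rightarrow> 'a \<Rightarrow> 'a"   \<comment> \<open>\<open>Comp C g f\<close> is \<open>g\<close> after \<open>f\<close>\<close>

definition Hom :: "('o, 'a, 'z) cat_scheme \<Rightarrow> 'o \<Rightarrow> 'o \<Rightarrow> 'a set" where
  "Hom C a b = {f \<in> Arr C. Dom C f = a \<and> Cod C f = b}"

locale category =
  fixes C :: "('o, 'a, 'z) cat_scheme"
  assumes Dom_in: "f \<in> Arr C \<Longrightarrow> Dom C f \<in> Obj C"
    and Cod_in: "f \<in> Arr C \<Longrightarrow> Cod C f \<in> Obj C"
    and Ide_in: "a \<in> Obj C \<Longrightarrow> Ide C a \<in> Hom C a a"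
    and Comp_in: "\<lbrakk>f \<in> Hom C a b; g \<in> Hom C b c\<rbrakk> \<Longrightarrow> Comp C g f \<in> Hom C a c"
    and Comp_Ide: "f \<in> Hom C a b \<Longrightarrow> Comp C f (Ide C a) = f"
    and Ide_Comp: "f \<in> Hom C a b \<Longrightarrow> Comp C (Ide C b) f = f"
    and Comp_assoc: "\<lbrakk>f \<in> Hom C a b; g \<in> Hom C b c; h \<in> Hom C c d\<rbrakk>
      \<Longrightarrow> Comp C h (Comp C g f) = Comp C (Comp C h g) f"

record ('o, 'a, 'p, 'b) funct =
  omap :: "'o \<Rightarrow> 'p"
  amap :: "'a \<Rightarrow> 'b"

text \<open>Both components are extensional, so equality of functors with a given source and target
  is equality in HOL.\<close>

definition is_functor ::
  "('o, 'a, 'p, 'b) funct \<Rightarrow> ('o, 'a, 'z) cat_scheme \<Rightarrow> ('p, 'b, 'y) cat_scheme \<Rightarrow> bool" where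
  "is_functor F C D \<longleftrightarrow>
     omap F \<in> Obj C \<rightarrow>\<^sub>E Obj D \<and>
     amap F \<in> Arr C \<rightarrow>\<^sub>E Arr D \<and>
     (\<forall>f\<in>Arr C. Dom D (amap F f) = omap F (Dom C f) \<and> Cod D (amap F f) = omap F (Cod C f)) \<and>
     (\<forall>a\<in>Obj C. amap F (Ide C a) = Ide D (omap F a)) \<and>
     (\<forall>f\<in>Arr C. \<forall>g\<in>Arr C. Cod C f = Dom C g \<longrightarrow>
        amap F (Comp C g f) = Comp D (amap F g) (amap F f))"

definition faithful ::
  "('o, 'a, 'p, 'b) funct \<Rightarrow> ('o, 'a, 'z) cat_scheme \<Rightarrow> bool" where
  "faithful F C \<longleftrightarrow> (\<forall>a\<in>Obj C. \<forall>b\<in>Obj C. inj_on (amap F) (Hom C a b))"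

definition id_functor :: "('o, 'a, 'z) cat_scheme \<Rightarrow> ('o, 'a, 'o, 'a) funct" where
  "id_functor C = \<lparr>omap = restrict (\<lambda>a. a) (Obj C), amap = restrict (\<lambda>f. f) (Arr C)\<rparr>"

definition comp_functor ::
  "('o, 'a, 'z) cat_scheme \<Rightarrow> ('p, 'b, 'q, 'c) funct \<Rightarrow> ('o, 'a, 'p, 'b) funct
    \<Rightarrow> ('o, 'a, 'q, 'c) funct" where
  "comp_functor C G F =
     \<lparr>omap = restrict (\<lambda>a. omap G (omap F a)) (Obj C),
      amap = restrict (\<lambda>f. amap G (amap F f)) (Arr C)\<rparr>"

definition iso_arr :: "('o, 'a, 'z) cat_scheme \<Rightarrow> 'a \<Rightarrow> bool" where
  "iso_arr C f \<longleftrightarrow> f \<in> Arr C \<and>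
     (\<exists>g \<in> Hom C (Cod C f) (Dom C f).
        Comp C g f = Ide C (Dom C f) \<and> Comp C f g = Ide C (Cod C f))"

definition naturally_isomorphic ::
  "('o, 'a, 'z) cat_scheme \<Rightarrow> ('p, 'b, 'y) cat_scheme
    \<Rightarrow> ('o, 'a, 'p, 'b) funct \<Rightarrow> ('o, 'a, 'p, 'b) funct \<Rightarrow> bool" where
  "naturally_isomorphic C D F G \<longleftrightarrow>
     (\<exists>\<eta>. (\<forall>a\<in>Obj C. \<eta> a \<in> Hom D (omap F a) (omap G a) \<and> iso_arr D (\<eta> a)) \<and>
          (\<forall>f\<in>Arr C. Comp D (\<eta> (Cod C f)) (amap F f) = Comp D (amap G f) (\<eta> (Dom C f))))"

definition is_equivalence ::
  "('o, 'a, 'p, 'b) funct \<Rightarrow> ('o, 'a, 'z) cat_scheme \<Rightarrow> ('p, 'b, 'y) cat_scheme \<Rightarrow> bool" where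
  "is_equivalence F C D \<longleftrightarrow> is_functor F C D \<and>
     (\<exists>G. is_functor G D C \<and>
          naturally_isomorphic C C (comp_functor C G F) (id_functor C) \<and>
          naturally_isomorphic D D (comp_functor D F G) (id_functor D))"


section \<open>Localization of a category at a class of arrows\<close>

text \<open>The Gabriel--Zisman construction: arrows are zigzags in which the arrows of \<open>W\<close> may be
  traversed backwards, modulo the least congruence that makes the inclusion of \<open>C\<close> a functor
  and each backward step inverse to the corresponding forward step.  Zigzags are lists of steps,
  the first step of the path being the head of the list.\<close>

datatype 'a step = Fwd 'a | Bwd 'a

inductive zigzag :: "('o, 'a, 'z) cat_scheme \<Rightarrow> 'a set \<Rightarrow> 'o \<Rightarrow> 'a step list \<Rightarrow> 'o \<Rightarrow> bool"
  for C :: "('o, 'a, 'z) cat_scheme" and W :: "'a set" where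
  Nil: "a \<in> Obj C \<Longrightarrow> zigzag C W a [] a"
| Fwd: "\<lbrakk>f \<in> Hom C a b; zigzag C W b p c\<rbrakk> \<Longrightarrow> zigzag C W a (Fwd f # p) c"
| Bwd: "\<lbrakk>w \<in> W; w \<in> Hom C b a; zigzag C W b p c\<rbrakk> \<Longrightarrow> zigzag C W a (Bwd w # p) c"

inductive zigzag_eq ::
  "('o, 'a, 'z) cat_scheme \<Rightarrow> 'a set \<Rightarrow> 'o \<Rightarrow> 'o \<Rightarrow> 'a step list \<Rightarrow> 'a step list \<Rightarrow> bool"
  for C :: "('o, 'a, 'z) cat_scheme" and W :: "'a set" where
  refl: "zigzag C W a p b \<Longrightarrow> zigzag_eq C W a b p p"
| sym: "zigzag_eq C W a b p q \<Longrightarrow> zigzag_eq C W a b q p"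
| trans: "\<lbrakk>zigzag_eq C W a b p q; zigzag_eq C W a b q r\<rbrakk> \<Longrightarrow> zigzag_eq C W a b p r"
| cong: "\<lbrakk>zigzag C W a p b; zigzag_eq C W b c q q'; zigzag C W c r d\<rbrakk>
    \<Longrightarrow> zigzag_eq C W a d (p @ q @ r) (p @ q' @ r)"
| ide: "a \<in> Obj C \<Longrightarrow> zigzag_eq C W a a [Fwd (Ide C a)] []"
| comp: "\<lbrakk>f \<in> Hom C a b; g \<in> Hom C b c\<rbrakk> \<Longrightarrow> zigzag_eq C W a c [Fwd f, Fwd g] [Fwd (Comp C g f)]"
| inv1: "\<lbrakk>w \<in> W; w \<in> Hom C a b\<rbrakk> \<Longrightarrow> zigzag_eq C W a a [Fwd w, Bwd w] []"
| inv2: "\<lbrakk>w \<in> W; w \<in> Hom C a b\<rbrakk> \<Longrightarrow> zigzag_eq C W b b [Bwd w, Fwd w] []"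

definition zigzag_class ::
  "('o, 'a, 'z) cat_scheme \<Rightarrow> 'a set \<Rightarrow> 'o \<Rightarrow> 'a step list \<Rightarrow> 'o \<Rightarrow> 'o \<times> 'a step list set \<times> 'o" where
  "zigzag_class C W a p b = (a, {q. zigzag_eq C W a b p q}, b)"

definition localization ::
  "('o, 'a, 'z) cat_scheme \<Rightarrow> 'a set \<Rightarrow> ('o, 'o \<times> 'a step list set \<times> 'o) cat" where
  "localization C W =
     \<lparr>Obj = Obj C,
      Arr = {zigzag_class C W a p b | a p b. zigzag C W a p b},
      Dom = (\<lambda>(a, P, b). a),
      Cod = (\<lambda>(a, P, b). b),
      Ide = (\<lambda>a. zigzag_class C W a [] a),
      Comp = (\<lambda>(b, Q, c) (a, P, b'). (a, {r. \<exists>p\<in>P. \<exists>q\<in>Q. zigzag_eq C W a c (p @ q) r}, c))\<rparr>"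


section \<open>Small sets and small categories\<close>

text \<open>HOL has no set of all small sets, so smallness is relative to a type \<open>'u\<close>: a set is small
  if it is a subset of \<open>'u\<close> of cardinality strictly below that of \<open>'u\<close>, and a category is small
  if its objects and its arrows form small sets.  If \<open>'u\<close> has (strongly) inaccessible
  cardinality \<open>\<kappa>\<close>, these are, up to bijection, the elements of the Grothendieck universe
  \<open>V\<^sub>\<kappa>\<close>, and \<open>Set_cat\<close> and \<open>Cat\<close> below are equivalent to the usual categories of small sets and
  of small categories.  Inaccessibility itself is not assumed anywhere.\<close>

definition small :: "'u set \<Rightarrow> bool" where
  "small A \<longleftrightarrow> A \<prec> (UNIV :: 'u set)"

text \<open>An arrow of \<open>Set_cat\<close> or \<open>Cat\<close> is a triple (source, map, target).\<close>

definition Set_cat :: "('u set, 'u set \<times> ('u \<Rightarrow> 'u) \<times> 'u set) cat" where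
  "Set_cat =
     \<lparr>Obj = {A. small A},
      Arr = {(A, f, B). small A \<and> small B \<and> f \<in> A \<rightarrow>\<^sub>E B},
      Dom = (\<lambda>(A, f, B). A),
      Cod = (\<lambda>(A, f, B). B),
      Ide = (\<lambda>A. (A, restrict (\<lambda>x. x) A, A)),
      Comp = (\<lambda>(B, g, C) (A, f, B'). (A, compose A g f, C))\<rparr>"

text \<open>The structure maps take the value \<open>undefined\<close> outside their domains, so that each small
  category is represented by exactly one record.\<close>

definition small_category :: "('u, 'u) cat \<Rightarrow> bool" where
  "small_category A \<longleftrightarrow> category A \<and> small (Obj A) \<and> small (Arr A) \<and>
     Dom A \<in> extensional (Arr A) \<and> Cod A \<in> extensional (Arr A) \<and>
     Ide A \<in> extensional (Obj A) \<and>
     (\<forall>g f. \<not> (f \<in> Arr A \<and> g \<in> Arr A \<and> Cod A f = Dom A g) \<longrightarrow> Comp A g f = undefined)"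

type_synonym 'u cat_arr = "('u, 'u) cat \<times> ('u, 'u, 'u, 'u) funct \<times> ('u, 'u) cat"

definition Cat :: "(('u, 'u) cat, 'u cat_arr) cat" where
  "Cat =
     \<lparr>Obj = {A. small_category A},
      Arr = {(A, F, B). small_category A \<and> small_category B \<and> is_functor F A B},
      Dom = (\<lambda>(A, F, B). A),
      Cod = (\<lambda>(A, F, B). B),
      Ide = (\<lambda>A. (A, id_functor A, A)),
      Comp = (\<lambda>(B, G, C) (A, F, B'). (A, comp_functor A G F, C))\<rparr>"


section \<open>The folk model structure and its homotopy category\<close>

text \<open>Only the data of a model structure; the homotopy category depends on nothing but the
  underlying category and the weak equivalences.\<close>

record ('o, 'a) model_structure = "('o, 'a) cat" +
  Weq :: "'a set"
  Cof :: "'a set"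
  Fib :: "'a set"

definition right_lifting :: "('o, 'a, 'z) cat_scheme \<Rightarrow> 'a set \<Rightarrow> 'a set" where
  "right_lifting C I = {p \<in> Arr C. \<forall>i\<in>I.
     \<forall>t\<in>Hom C (Dom C i) (Dom C p). \<forall>b\<in>Hom C (Cod C i) (Cod C p).
       Comp C p t = Comp C b i \<longrightarrow>
       (\<exists>h\<in>Hom C (Cod C i) (Dom C p). Comp C h i = t \<and> Comp C p h = b)}"

definition ho :: "('o, 'a) model_structure \<Rightarrow> ('o, 'o \<times> 'a step list set \<times> 'o) cat" where
  "ho M = localization M (Weq M)"

definition equivalences :: "'u cat_arr set" where
  "equivalences = {(A, F, B). (A, F, B) \<in> Arr Cat \<and> is_equivalence F A B}"

definition injective_on_objects :: "'u cat_arr set" where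
  "injective_on_objects = {(A, F, B). (A, F, B) \<in> Arr Cat \<and> inj_on (omap F) (Obj A)}"

definition folk_Cat :: "'u itself \<Rightarrow> (('u, 'u) cat, 'u cat_arr) model_structure" where
  "folk_Cat _ = cat.extend Cat
     \<lparr>Weq = equivalences,
      Cof = injective_on_objects,
      Fib = right_lifting Cat (injective_on_objects \<inter> equivalences)\<rparr>"

definition concrete :: "'u itself \<Rightarrow> ('o, 'a, 'z) cat_scheme \<Rightarrow> bool" where
  "concrete _ C \<longleftrightarrow>
     (\<exists>F :: ('o, 'a, 'u set, 'u set \<times> ('u \<Rightarrow> 'u) \<times> 'u set) funct.
        is_functor F C Set_cat \<and> faithful F C)"

end

theory Submission
  imports Defs
begin

text \<open>
  A faithful functor \<open>F\<close> from \<open>ho(Cat)\<close> to small sets is refuted by a transfinite version of Freyd's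
  argument.  Well-order \<open>'u\<close> so that all proper initial segments are small.  It suffices to find a
  small category \<open>A\<close>, pairs \<open>u\<^sub>i, v\<^sub>i : Z\<^sub>i \<rightarrow> A\<close> and functors \<open>g\<^sub>j : A \<rightarrow> Y\<^sub>j\<close> such that
  \<open>g\<^sub>j u\<^sub>i\<close> and \<open>g\<^sub>j v\<^sub>i\<close> agree in \<open>ho(Cat)\<close>, that is, are naturally isomorphic, if \<open>i < j\<close> but not
  if \<open>i = j\<close>: such a system makes \<open>'u\<close> inject into the square of the small set \<open>F A\<close>.

  As in Freyd's proof the system comes from heights.  Let \<open>U\<^sub>j\<close> be the vector space over the field
  with two elements on the tree of descending sequences below \<open>j\<close>, with the operator \<open>d\<close> that maps
  each node to its parent and the root to \<open>0\<close>.  The category \<open>A\<close> consists of parallel arrows between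
  two objects.  In \<open>Y\<^sub>j\<close> both objects acquire the automorphism group \<open>U\<^sub>j\<close>, which acts on the arrows
  in such a way that naturality of a transformation at a suitable pair of arrows of \<open>A\<close> is an
  equation \<open>x = y\<close>, \<open>x = d y\<close> or \<open>x = root\<close> between its components.  The category \<open>Z\<^sub>i\<close> is the tree of
  descending sequences of elements \<open>\<le> i\<close>, so an isomorphism between \<open>g\<^sub>j u\<^sub>i\<close> and \<open>g\<^sub>j v\<^sub>i\<close> is a map
  \<open>\<xi>\<close> from its nodes to \<open>U\<^sub>j\<close> that sends the root to the root and satisfies
  \<open>d (\<xi> child) = \<xi> parent\<close>.  It exists exactly if the root of the tree of \<open>Y\<^sub>j\<close> has sufficient height.
\<close>

section \<open>Cardinal arithmetic: products and sets of finite subsets stay below an infinite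
  cardinal\<close>

unbundle cardinal_syntax

lemma lepoll_iff_ordLeq: "A \<lesssim> B \<longleftrightarrow> |A| \<le>o |B|"
  by (auto simp: lepoll_def card_of_ordLeq)

lemma lesspoll_iff_ordLess: "A \<prec> B \<longleftrightarrow> |A| <o |B|"
proof -
  have "|A| <o |B| \<longleftrightarrow> \<not> B \<lesssim> A"
    unfolding lepoll_def by (rule card_of_ordLess[symmetric])
  moreover have "A \<lesssim> B" if "|A| <o |B|"
    using that ordLess_imp_ordLeq lepoll_iff_ordLeq by blast
  ultimately show ?thesis
    unfolding lesspoll_def using eqpoll_imp_lepoll[of B A] eqpoll_sym[of A B] lepoll_antisym[of A B]
    by blast
qed

lemma Times_lepoll_infinite:
  assumes "infinite C" "A \<lesssim> C" "B \<lesssim> C"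
  shows "A \<times> B \<lesssim> C"
  using assms card_of_Sigma_ordLeq_infinite[of C A "\<lambda>_. B"] by (auto simp: lepoll_iff_ordLeq)

text \<open>Unless both factors are finite, the disjoint sum \<open>A <+> B\<close> is infinite,
  bounds both factors and hence their product, and stays below \<open>C\<close>. So the bound holds
  at every infinite cardinal.\<close>

lemma Times_lesspoll_infinite:
  assumes "infinite C" "A \<prec> C" "B \<prec> C"
  shows "A \<times> B \<prec> C"
proof -
  have "A <+> B \<prec> C"
    using assms by (simp add: lesspoll_iff_ordLess card_of_Plus_ordLess_infinite)
  show ?thesis
  proof (cases "finite A \<and> finite B")
    case True
    then show ?thesis using assms(1) by (simp add: finite_lesspoll_infinite)
  next
    case False
    then have "infinite (A <+> B)" by simp
    then have "A \<times> B \<lesssim> A <+> B"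
      by (rule Times_lepoll_infinite) (auto simp: lepoll_iff_ordLeq card_of_Plus1 card_of_Plus2)
    then show ?thesis using \<open>A <+> B \<prec> C\<close> by (rule lesspoll_trans1)
  qed
qed

lemma Un_lesspoll_infinite:
  assumes "infinite C" "A \<prec> C" "B \<prec> C"
  shows "A \<union> B \<prec> C"
  using assms by (simp add: lesspoll_iff_ordLess card_of_Un_ordLess_infinite)

lemma Plus_lesspoll_infinite:
  assumes "infinite C" "A \<prec> C" "B \<prec> C"
  shows "A <+> B \<prec> C"
  using assms by (simp add: lesspoll_iff_ordLess card_of_Plus_ordLess_infinite)

lemma image_lesspoll: "A \<prec> C \<Longrightarrow> f ` A \<prec> C"
  using image_lepoll lesspoll_trans1 by blast

text \<open>Splitting by cardinality gives countably many pieces; each is bounded by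
  \<open>A\<close>, since a subset of size \<open>Suc n\<close> arises by inserting an element into
  one of size \<open>n\<close>.\<close>

lemma Fpow_lepoll_infinite:
  assumes "infinite A"
  shows "Fpow A \<lesssim> A"
proof -
  have *: "{X. X \<subseteq> A \<and> finite X \<and> card X = n} \<lesssim> A" for n
  proof (induction n)
    case 0
    have "{X. X \<subseteq> A \<and> finite X \<and> card X = 0} = {{}}" by auto
    then show ?case using assms by (simp add: finite_lepoll_infinite)
  next
    case (Suc n)
    have "{X. X \<subseteq> A \<and> finite X \<and> card X = Suc n}
        \<subseteq> (\<lambda>(a, X). insert a X) ` (A \<times> {X. X \<subseteq> A \<and> finite X \<and> card X = n})"
      by (force simp: card_Suc_eq)
    moreover have "A \<times> {X. X \<subseteq> A \<and> finite X \<and> card X = n} \<lesssim> A"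
      using Suc.IH assms by (intro Times_lepoll_infinite) auto
    ultimately show ?case
      by (meson image_lepoll lepoll_trans subset_imp_lepoll)
  qed
  have "Fpow A = (\<Union>n. {X. X \<subseteq> A \<and> finite X \<and> card X = n})"
    by (auto simp: Fpow_def)
  moreover have "|\<Union>n::nat. {X. X \<subseteq> A \<and> finite X \<and> card X = n}| \<le>o |A|"
    using assms * infinite_iff_card_of_nat
    by (intro card_of_UNION_ordLeq_infinite) (auto simp: lepoll_iff_ordLeq)
  ultimately show ?thesis by (simp add: lepoll_iff_ordLeq)
qed

lemma Fpow_lesspoll_infinite:
  assumes "infinite C" "A \<prec> C"
  shows "Fpow A \<prec> C"
proof (cases "finite A")
  case True
  then have "finite (Fpow A)" by (simp add: finite_subset[OF Fpow_subset_Pow])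
  then show ?thesis using assms(1) by (simp add: finite_lesspoll_infinite)
next
  case False
  then show ?thesis using assms(2) Fpow_lepoll_infinite lesspoll_trans1 by blast
qed


section \<open>Functors and natural isomorphisms\<close>

lemma Hom_iff: "f \<in> Hom C a b \<longleftrightarrow> f \<in> Arr C \<and> Dom C f = a \<and> Cod C f = b"
  by (auto simp: Hom_def)

lemma (in category) Hom_Obj: "f \<in> Hom C a b \<Longrightarrow> a \<in> Obj C \<and> b \<in> Obj C"
  using Dom_in Cod_in by (auto simp: Hom_iff)

lemma functor_omap: "is_functor F C D \<Longrightarrow> a \<in> Obj C \<Longrightarrow> omap F a \<in> Obj D"
  by (auto simp: is_functor_def)

lemma functor_extensional:
  assumes "is_functor F C D"
  shows "a \<notin> Obj C \<Longrightarrow> omap F a = undefined" "f \<notin> Arr C \<Longrightarrow> amap F f = undefined"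
  using assms by (auto simp: is_functor_def PiE_def extensional_def)

lemma functor_Hom:
  "is_functor F C D \<Longrightarrow> f \<in> Hom C a b \<Longrightarrow> amap F f \<in> Hom D (omap F a) (omap F b)"
  by (auto simp: is_functor_def Hom_iff)

lemma functor_Ide: "is_functor F C D \<Longrightarrow> a \<in> Obj C \<Longrightarrow> amap F (Ide C a) = Ide D (omap F a)"
  by (auto simp: is_functor_def)

lemma functor_Comp:
  "is_functor F C D \<Longrightarrow> f \<in> Hom C a b \<Longrightarrow> g \<in> Hom C b c \<Longrightarrow>
    amap F (Comp C g f) = Comp D (amap F g) (amap F f)"
  by (auto simp: is_functor_def Hom_iff)

lemma functor_eqI:
  assumes "is_functor F C D" "is_functor G C D"
    and "\<And>a. a \<in> Obj C \<Longrightarrow> omap F a = omap G a"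
    and "\<And>f. f \<in> Arr C \<Longrightarrow> amap F f = amap G f"
  shows "F = G"
proof -
  have "omap F = omap G" "amap F = amap G"
    using assms by (auto simp: is_functor_def intro: PiE_ext)
  then show ?thesis by simp
qed

lemma is_functorI:
  assumes "category C"
    and "omap F \<in> extensional (Obj C)" "amap F \<in> extensional (Arr C)"
    and "\<And>a. a \<in> Obj C \<Longrightarrow> omap F a \<in> Obj D"
    and hom: "\<And>f a b. f \<in> Hom C a b \<Longrightarrow> amap F f \<in> Hom D (omap F a) (omap F b)"
    and "\<And>a. a \<in> Obj C \<Longrightarrow> amap F (Ide C a) = Ide D (omap F a)"
    and comp: "\<And>f g a b c. f \<in> Hom C a b \<Longrightarrow> g \<in> Hom C b c \<Longrightarrow>
      amap F (Comp C g f) = Comp D (amap F g) (amap F f)"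
  shows "is_functor F C D"
proof -
  have "amap F f \<in> Hom D (omap F (Dom C f)) (omap F (Cod C f))" if "f \<in> Arr C" for f
    using hom that by (auto simp: Hom_iff)
  then show ?thesis
    using assms(2-4,6) comp unfolding is_functor_def
    by (auto simp: PiE_def Hom_iff)
qed

lemma omap_id [simp]: "a \<in> Obj C \<Longrightarrow> omap (id_functor C) a = a"
  and amap_id [simp]: "f \<in> Arr C \<Longrightarrow> amap (id_functor C) f = f"
  by (auto simp: id_functor_def)

lemma omap_comp [simp]: "a \<in> Obj C \<Longrightarrow> omap (comp_functor C G F) a = omap G (omap F a)"
  and amap_comp [simp]: "f \<in> Arr C \<Longrightarrow> amap (comp_functor C G F) f = amap G (amap F f)"
  by (auto simp: comp_functor_def)

context category
begin

lemma Ide_Arr [simp]: "a \<in> Obj C \<Longrightarrow> Ide C a \<in> Arr C"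
  using Ide_in by (auto simp: Hom_iff)

lemma Comp_Arr: "f \<in> Hom C a b \<Longrightarrow> g \<in> Hom C b c \<Longrightarrow> Comp C g f \<in> Arr C"
  using Comp_in by (auto simp: Hom_iff)

lemma Arr_Hom: "f \<in> Arr C \<Longrightarrow> f \<in> Hom C (Dom C f) (Cod C f)"
  by (simp add: Hom_iff)

lemma is_functor_id: "is_functor (id_functor C) C C"
proof (rule is_functorI)
  show "category C" by unfold_locales
qed (auto simp: id_functor_def Hom_iff Dom_in Cod_in dest: Comp_Arr Ide_in intro: Comp_Arr)

lemma is_functor_comp:
  assumes F: "is_functor F C D" and G: "is_functor G D E"
  shows "is_functor (comp_functor C G F) C E"
proof (rule is_functorI)
  show "category C" by unfold_locales
next
  fix f a b assume f: "f \<in> Hom C a b"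
  then have "amap G (amap F f) \<in> Hom E (omap G (omap F a)) (omap G (omap F b))"
    using functor_Hom[OF F] functor_Hom[OF G] by blast
  then show "amap (comp_functor C G F) f
      \<in> Hom E (omap (comp_functor C G F) a) (omap (comp_functor C G F) b)"
    using f Hom_Obj[OF f] by (simp add: Hom_iff)
next
  fix f g a b c assume f: "f \<in> Hom C a b" and g: "g \<in> Hom C b c"
  then have "amap G (amap F (Comp C g f)) = Comp E (amap G (amap F g)) (amap G (amap F f))"
    using functor_Comp[OF F] functor_Comp[OF G] functor_Hom[OF F] by metis
  then show "amap (comp_functor C G F) (Comp C g f)
      = Comp E (amap (comp_functor C G F) g) (amap (comp_functor C G F) f)"
    using f g Comp_Arr[OF f g] by (simp add: Hom_iff)
qed (use functor_omap[OF F] functor_omap[OF G] functor_Ide[OF F] functor_Ide[OF G] in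
    \<open>auto simp: comp_functor_def\<close>)

lemma comp_functor_assoc:
  assumes "is_functor F C D"
  shows "comp_functor C H (comp_functor C G F) = comp_functor C (comp_functor D H G) F"
  using functor_omap[OF assms] functor_Hom[OF assms Arr_Hom]
  by (auto simp: comp_functor_def restrict_def fun_eq_iff Hom_iff)

lemma comp_id_functor:
  assumes "is_functor F C D"
  shows "comp_functor C (id_functor D) F = F"
  using functor_omap[OF assms] functor_Hom[OF assms Arr_Hom] functor_extensional[OF assms]
  by (intro funct.equality) (auto simp: comp_functor_def id_functor_def restrict_def Hom_iff)

lemma comp_functor_id:
  assumes "is_functor F C D"
  shows "comp_functor C F (id_functor C) = F"
  using functor_omap[OF assms] functor_Hom[OF assms Arr_Hom] functor_extensional[OF assms]
  by (intro funct.equality) (auto simp: comp_functor_def id_functor_def restrict_def Hom_iff)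

lemma iso_arr_Ide: "a \<in> Obj C \<Longrightarrow> iso_arr C (Ide C a)"
  using Ide_in[of a] Ide_Comp[OF Ide_in[of a]]
  unfolding iso_arr_def Hom_iff by (auto intro!: bexI[of _ "Ide C a"] simp: Hom_iff)

lemma iso_arr_iff:
  assumes "f \<in> Hom C a b"
  shows "iso_arr C f \<longleftrightarrow> (\<exists>g \<in> Hom C b a. Comp C g f = Ide C a \<and> Comp C f g = Ide C b)"
  using assms by (auto simp: iso_arr_def Hom_iff)

lemma iso_arr_Comp:
  assumes f: "f \<in> Hom C a b" and g: "g \<in> Hom C b c" and "iso_arr C f" "iso_arr C g"
  shows "iso_arr C (Comp C g f)"
proof -
  obtain f' where f': "f' \<in> Hom C b a" "Comp C f' f = Ide C a" "Comp C f f' = Ide C b"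
    using assms iso_arr_iff[OF f] by auto
  obtain g' where g': "g' \<in> Hom C c b" "Comp C g' g = Ide C b" "Comp C g g' = Ide C c"
    using assms iso_arr_iff[OF g] by auto
  have 1: "Comp C f' g' \<in> Hom C c a" using f' g' Comp_in by blast
  have "Comp C (Comp C f' g') (Comp C g f) = Comp C f' (Comp C (Comp C g' g) f)"
    using Comp_assoc[OF f g g'(1)] Comp_assoc[OF Comp_in[OF f g] g'(1) f'(1)] by simp
  then have 2: "Comp C (Comp C f' g') (Comp C g f) = Ide C a"
    using g' f' Ide_Comp[OF f] by simp
  have "Comp C (Comp C g f) (Comp C f' g') = Comp C g (Comp C (Comp C f f') g')"
    using Comp_assoc[OF g'(1) f'(1) f] Comp_assoc[OF 1 f g] by simp
  then have 3: "Comp C (Comp C g f) (Comp C f' g') = Ide C c"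
    using g' f' Ide_Comp[OF g'(1)] by simp
  show ?thesis using iso_arr_iff[OF Comp_in[OF f g]] 1 2 3 by blast
qed

end

lemma functor_iso:
  assumes "category C" and F: "is_functor F C D" and f: "f \<in> Hom C a b" and "iso_arr C f"
    and "category D"
  shows "iso_arr D (amap F f)"
proof -
  interpret C: category C by fact
  interpret D: category D by fact
  obtain g where g: "g \<in> Hom C b a" "Comp C g f = Ide C a" "Comp C f g = Ide C b"
    using assms C.iso_arr_iff[OF f] by auto
  have "a \<in> Obj C" "b \<in> Obj C" using C.Hom_Obj[OF f] by auto
  then show ?thesis
    using D.iso_arr_iff[OF functor_Hom[OF F f]] functor_Hom[OF F g(1)]
      functor_Comp[OF F f g(1)] functor_Comp[OF F g(1) f] functor_Ide[OF F] g by metis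
qed

lemma natural_iso_refl:
  assumes "category C" "category D" and F: "is_functor F C D"
  shows "naturally_isomorphic C D F F"
proof -
  interpret C: category C by fact
  interpret D: category D by fact
  have "Comp D (Ide D (omap F (Cod C f))) (amap F f) = amap F f"
    "Comp D (amap F f) (Ide D (omap F (Dom C f))) = amap F f" if "f \<in> Arr C" for f
    using functor_Hom[OF F C.Arr_Hom[OF that]] D.Ide_Comp D.Comp_Ide by auto
  then show ?thesis unfolding naturally_isomorphic_def
    by (intro exI[of _ "\<lambda>a. Ide D (omap F a)"])
      (auto simp: D.Ide_in D.iso_arr_Ide functor_omap[OF F])
qed

lemma natural_iso_sym:
  assumes "category C" "category D" and F: "is_functor F C D" and G: "is_functor G C D"
    and "naturally_isomorphic C D F G"
  shows "naturally_isomorphic C D G F"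
proof -
  interpret C: category C by fact
  interpret D: category D by fact
  obtain \<eta> where \<eta>: "\<And>a. a \<in> Obj C \<Longrightarrow> \<eta> a \<in> Hom D (omap F a) (omap G a)"
    "\<And>a. a \<in> Obj C \<Longrightarrow> iso_arr D (\<eta> a)"
    and nat: "\<And>f. f \<in> Arr C \<Longrightarrow>
      Comp D (\<eta> (Cod C f)) (amap F f) = Comp D (amap G f) (\<eta> (Dom C f))"
    using assms(5) unfolding naturally_isomorphic_def by blast
  have "\<forall>a\<in>Obj C. \<exists>t. t \<in> Hom D (omap G a) (omap F a) \<and>
      Comp D t (\<eta> a) = Ide D (omap F a) \<and> Comp D (\<eta> a) t = Ide D (omap G a)"
    using \<eta> D.iso_arr_iff by blast
  then obtain \<theta> where \<theta>: "\<And>a. a \<in> Obj C \<Longrightarrow> \<theta> a \<in> Hom D (omap G a) (omap F a)"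
      "\<And>a. a \<in> Obj C \<Longrightarrow> Comp D (\<theta> a) (\<eta> a) = Ide D (omap F a)"
      "\<And>a. a \<in> Obj C \<Longrightarrow> Comp D (\<eta> a) (\<theta> a) = Ide D (omap G a)"
    by metis
  have "Comp D (\<theta> (Cod C f)) (amap G f) = Comp D (amap F f) (\<theta> (Dom C f))" if "f \<in> Arr C" for f
  proof -
    let ?a = "Dom C f" and ?b = "Cod C f"
    have ab: "?a \<in> Obj C" "?b \<in> Obj C" using that C.Dom_in C.Cod_in by auto
    note Ff = functor_Hom[OF F C.Arr_Hom[OF that]] and Gf = functor_Hom[OF G C.Arr_Hom[OF that]]
    have "Comp D (\<theta> ?b) (amap G f) = Comp D (\<theta> ?b) (Comp D (amap G f) (Comp D (\<eta> ?a) (\<theta> ?a)))"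
      using \<theta>(3)[OF ab(1)] D.Comp_Ide[OF Gf] by simp
    also have "\<dots> = Comp D (\<theta> ?b) (Comp D (Comp D (\<eta> ?b) (amap F f)) (\<theta> ?a))"
      using D.Comp_assoc[OF \<theta>(1)[OF ab(1)] \<eta>(1)[OF ab(1)] Gf] nat[OF that] by simp
    also have "\<dots> = Comp D (Comp D (\<theta> ?b) (Comp D (\<eta> ?b) (amap F f))) (\<theta> ?a)"
      using D.Comp_assoc[OF \<theta>(1)[OF ab(1)] D.Comp_in[OF Ff \<eta>(1)[OF ab(2)]] \<theta>(1)[OF ab(2)]] by simp
    also have "\<dots> = Comp D (amap F f) (\<theta> ?a)"
      using D.Comp_assoc[OF Ff \<eta>(1)[OF ab(2)] \<theta>(1)[OF ab(2)]] \<theta>(2)[OF ab(2)] D.Ide_Comp[OF Ff]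
      by simp
    finally show ?thesis .
  qed
  moreover have "iso_arr D (\<theta> a)" if "a \<in> Obj C" for a
    using D.iso_arr_iff[OF \<theta>(1)[OF that]] \<theta>(2,3)[OF that] \<eta>(1)[OF that] by blast
  ultimately show ?thesis
    unfolding naturally_isomorphic_def using \<theta>(1) by (intro exI[of _ \<theta>]) blast
qed

lemma natural_iso_trans:
  assumes "category C" "category D"
    and F: "is_functor F C D" and G: "is_functor G C D" and H: "is_functor H C D"
    and "naturally_isomorphic C D F G" "naturally_isomorphic C D G H"
  shows "naturally_isomorphic C D F H"
proof -
  interpret C: category C by fact
  interpret D: category D by fact
  obtain \<eta> where \<eta>: "\<And>a. a \<in> Obj C \<Longrightarrow> \<eta> a \<in> Hom D (omap F a) (omap G a)"
    "\<And>a. a \<in> Obj C \<Longrightarrow> iso_arr D (\<eta> a)"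
    and nat\<eta>: "\<And>f. f \<in> Arr C \<Longrightarrow>
      Comp D (\<eta> (Cod C f)) (amap F f) = Comp D (amap G f) (\<eta> (Dom C f))"
    using assms(6) unfolding naturally_isomorphic_def by blast
  obtain \<theta> where \<theta>: "\<And>a. a \<in> Obj C \<Longrightarrow> \<theta> a \<in> Hom D (omap G a) (omap H a)"
    "\<And>a. a \<in> Obj C \<Longrightarrow> iso_arr D (\<theta> a)"
    and nat\<theta>: "\<And>f. f \<in> Arr C \<Longrightarrow>
      Comp D (\<theta> (Cod C f)) (amap G f) = Comp D (amap H f) (\<theta> (Dom C f))"
    using assms(7) unfolding naturally_isomorphic_def by blast
  have "Comp D (Comp D (\<theta> (Cod C f)) (\<eta> (Cod C f))) (amap F f)
      = Comp D (amap H f) (Comp D (\<theta> (Dom C f)) (\<eta> (Dom C f)))" if "f \<in> Arr C" for f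
  proof -
    let ?a = "Dom C f" and ?b = "Cod C f"
    have ab: "?a \<in> Obj C" "?b \<in> Obj C" using that C.Dom_in C.Cod_in by auto
    note Ff = functor_Hom[OF F C.Arr_Hom[OF that]] and Gf = functor_Hom[OF G C.Arr_Hom[OF that]]
      and Hf = functor_Hom[OF H C.Arr_Hom[OF that]]
    show ?thesis
      using D.Comp_assoc[OF Ff \<eta>(1)[OF ab(2)] \<theta>(1)[OF ab(2)]]
        D.Comp_assoc[OF \<eta>(1)[OF ab(1)] Gf \<theta>(1)[OF ab(2)]]
        D.Comp_assoc[OF \<eta>(1)[OF ab(1)] \<theta>(1)[OF ab(1)] Hf] nat\<eta>[OF that] nat\<theta>[OF that] by simp
  qed
  then show ?thesis unfolding naturally_isomorphic_def
    by (intro exI[of _ "\<lambda>a. Comp D (\<theta> a) (\<eta> a)"])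
      (use \<eta> \<theta> D.Comp_in D.iso_arr_Comp in blast)
qed

lemma natural_iso_whisker_left:
  assumes "category C" "category D" "category E"
    and F: "is_functor F C D" and G: "is_functor G C D" and H: "is_functor H D E"
    and "naturally_isomorphic C D F G"
  shows "naturally_isomorphic C E (comp_functor C H F) (comp_functor C H G)"
proof -
  interpret C: category C by fact
  interpret D: category D by fact
  obtain \<eta> where \<eta>: "\<And>a. a \<in> Obj C \<Longrightarrow> \<eta> a \<in> Hom D (omap F a) (omap G a)"
    "\<And>a. a \<in> Obj C \<Longrightarrow> iso_arr D (\<eta> a)"
    and nat: "\<And>f. f \<in> Arr C \<Longrightarrow>
      Comp D (\<eta> (Cod C f)) (amap F f) = Comp D (amap G f) (\<eta> (Dom C f))"
    using assms(7) unfolding naturally_isomorphic_def by blast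
  have "Comp E (amap H (\<eta> (Cod C f))) (amap H (amap F f))
      = Comp E (amap H (amap G f)) (amap H (\<eta> (Dom C f)))" if "f \<in> Arr C" for f
    using functor_Comp[OF H functor_Hom[OF F C.Arr_Hom[OF that]] \<eta>(1)[OF C.Cod_in[OF that]]]
      functor_Comp[OF H \<eta>(1)[OF C.Dom_in[OF that]] functor_Hom[OF G C.Arr_Hom[OF that]]]
      nat[OF that] by simp
  moreover have "amap H (\<eta> a) \<in> Hom E (omap H (omap F a)) (omap H (omap G a))"
    "iso_arr E (amap H (\<eta> a))" if "a \<in> Obj C" for a
    using functor_Hom[OF H \<eta>(1)[OF that]] functor_iso[OF assms(2) H \<eta>(1)[OF that] \<eta>(2)[OF that]] assms
    by auto
  ultimately show ?thesis unfolding naturally_isomorphic_def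
    by (intro exI[of _ "\<lambda>a. amap H (\<eta> a)"]) auto
qed

lemma natural_iso_whisker_right:
  assumes "category B"
    and F: "is_functor F C D" and G: "is_functor G C D" and K: "is_functor K B C"
    and "naturally_isomorphic C D F G"
  shows "naturally_isomorphic B D (comp_functor B F K) (comp_functor B G K)"
proof -
  interpret B: category B by fact
  obtain \<eta> where \<eta>: "\<And>a. a \<in> Obj C \<Longrightarrow> \<eta> a \<in> Hom D (omap F a) (omap G a)"
    "\<And>a. a \<in> Obj C \<Longrightarrow> iso_arr D (\<eta> a)"
    and nat: "\<And>f. f \<in> Arr C \<Longrightarrow>
      Comp D (\<eta> (Cod C f)) (amap F f) = Comp D (amap G f) (\<eta> (Dom C f))"
    using assms(5) unfolding naturally_isomorphic_def by blast
  have "Comp D (\<eta> (omap K (Cod B f))) (amap F (amap K f))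
      = Comp D (amap G (amap K f)) (\<eta> (omap K (Dom B f)))" if "f \<in> Arr B" for f
    using nat[of "amap K f"] functor_Hom[OF K B.Arr_Hom[OF that]] by (auto simp: Hom_iff)
  then show ?thesis unfolding naturally_isomorphic_def
    by (intro exI[of _ "\<lambda>a. \<eta> (omap K a)"])
      (use \<eta> functor_omap[OF K] in \<open>auto simp: B.Dom_in B.Cod_in\<close>)
qed

text \<open>With \<open>G\<close> a quasi-inverse of \<open>F\<close>, whiskering by
  \<open>G\<close> links \<open>S\<close>, GFS, GFT and \<open>T\<close> by isomorphisms. This is
  injectivity of composition with \<open>F\<close> on isomorphism classes.\<close>

lemma equivalence_reflects_natural_iso:
  assumes cat: "category Z" "category A" "category B" and F: "is_equivalence F A B"
    and S: "is_functor S Z A" and T: "is_functor T Z A"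
    and iso: "naturally_isomorphic Z B (comp_functor Z F S) (comp_functor Z F T)"
  shows "naturally_isomorphic Z A S T"
proof -
  interpret Z: category Z by fact
  interpret A: category A by fact
  obtain G where F': "is_functor F A B" and G: "is_functor G B A"
    and GF: "naturally_isomorphic A A (comp_functor A G F) (id_functor A)"
    using F unfolding is_equivalence_def by blast
  let ?K = "comp_functor A G F"
  have K: "is_functor ?K A A" by (rule A.is_functor_comp[OF F' G])
  have *: "naturally_isomorphic Z A (comp_functor Z ?K R) R" if R: "is_functor R Z A" for R
    using natural_iso_whisker_right[OF cat(1) K A.is_functor_id R GF] Z.comp_id_functor[OF R] by simp
  have "naturally_isomorphic Z A (comp_functor Z G (comp_functor Z F S))
      (comp_functor Z G (comp_functor Z F T))"
    by (intro natural_iso_whisker_left[OF cat(1,3,2)] Z.is_functor_comp[OF _ F'] S T G iso)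
  then have **: "naturally_isomorphic Z A (comp_functor Z ?K S) (comp_functor Z ?K T)"
    by (simp add: Z.comp_functor_assoc[OF S] Z.comp_functor_assoc[OF T])
  note KS = Z.is_functor_comp[OF S K] and KT = Z.is_functor_comp[OF T K]
  show ?thesis
    using natural_iso_trans[OF cat(1,2) S KS T natural_iso_sym[OF cat(1,2) KS S *[OF S]]
        natural_iso_trans[OF cat(1,2) KS KT T ** *[OF T]]] .
qed

text \<open>The lift is \<open>T\<close> followed by a quasi-inverse \<open>G\<close>: surjectivity
  of composition with \<open>F\<close> on isomorphism classes.\<close>

lemma equivalence_lifts:
  assumes cat: "category Z" "category B" and F: "is_equivalence F A B" and T: "is_functor T Z B"
  shows "\<exists>S. is_functor S Z A \<and> naturally_isomorphic Z B (comp_functor Z F S) T"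
proof -
  interpret Z: category Z by fact
  interpret B: category B by fact
  obtain G where F': "is_functor F A B" and G: "is_functor G B A"
    and FG: "naturally_isomorphic B B (comp_functor B F G) (id_functor B)"
    using F unfolding is_equivalence_def by blast
  have "naturally_isomorphic Z B (comp_functor Z F (comp_functor Z G T)) T"
    using natural_iso_whisker_right[OF cat(1) B.is_functor_comp[OF G F'] B.is_functor_id T FG]
    by (simp add: Z.comp_id_functor[OF T] Z.comp_functor_assoc[OF T])
  then show ?thesis using Z.is_functor_comp[OF T G] by blast
qed


section \<open>Localizations\<close>

lemma zigzag_append:
  "zigzag C W a p b \<Longrightarrow> zigzag C W b q c \<Longrightarrow> zigzag C W a (p @ q) c"
  by (induction rule: zigzag.induct) (auto intro: zigzag.intros)

lemma (in category) zigzag_Obj: "zigzag C W a p b \<Longrightarrow> a \<in> Obj C \<and> b \<in> Obj C"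
  by (induction rule: zigzag.induct) (auto dest: Hom_Obj)

lemma (in category) zigzag_single: "f \<in> Hom C a b \<Longrightarrow> zigzag C W a [Fwd f] b"
  using Hom_Obj by (blast intro: zigzag.intros)

lemma (in category) zigzag_eq_zigzag:
  "zigzag_eq C W a b p q \<Longrightarrow> zigzag C W a p b \<and> zigzag C W a q b"
proof (induction rule: zigzag_eq.induct)
  case (comp f a b g c)
  then show ?case
    using Hom_Obj Comp_in by (blast intro: zigzag.intros)
qed (use Hom_Obj Ide_in in \<open>blast intro: zigzag.intros zigzag_append\<close>)+

context category
begin

lemma zigzag_eq_append:
  assumes "zigzag_eq C W a b p p'" "zigzag_eq C W b c q q'"
  shows "zigzag_eq C W a c (p @ q) (p' @ q')"
proof -
  have "zigzag_eq C W a c ([] @ p @ q) ([] @ p' @ q)"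
    using assms zigzag_eq_zigzag zigzag_Obj by (meson zigzag_eq.cong zigzag.Nil)
  moreover have "zigzag_eq C W a c (p' @ q @ []) (p' @ q' @ [])"
    using assms zigzag_eq_zigzag zigzag_Obj by (meson zigzag_eq.cong zigzag.Nil)
  ultimately show ?thesis using zigzag_eq.trans by simp
qed

lemma zigzag_class_eq_iff:
  assumes "zigzag C W a p b"
  shows "zigzag_class C W a p b = zigzag_class C W a q b \<longleftrightarrow> zigzag_eq C W a b p q"
proof
  assume "zigzag_class C W a p b = zigzag_class C W a q b"
  then have "zigzag_eq C W a b q p"
    using zigzag_eq.refl[OF assms] by (auto simp: zigzag_class_def)
  then show "zigzag_eq C W a b p q" by (rule zigzag_eq.sym)
next
  assume "zigzag_eq C W a b p q"
  then show "zigzag_class C W a p b = zigzag_class C W a q b"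
    unfolding zigzag_class_def by (auto intro: zigzag_eq.trans zigzag_eq.sym)
qed

text \<open>Composition in the localization ranges over all representatives of both classes; by
  congruence the result does not depend on their choice.\<close>

lemma localization_Comp:
  assumes "zigzag C W a p b" "zigzag C W b q c"
  shows "Comp (localization C W) (zigzag_class C W b q c) (zigzag_class C W a p b)
    = zigzag_class C W a (p @ q) c"
proof -
  have "{r. \<exists>p'\<in>{p'. zigzag_eq C W a b p p'}. \<exists>q'\<in>{q'. zigzag_eq C W b c q q'}.
      zigzag_eq C W a c (p' @ q') r} = {r. zigzag_eq C W a c (p @ q) r}" (is "?L = ?R")
  proof
    show "?L \<subseteq> ?R" by (auto intro: zigzag_eq.trans[OF zigzag_eq_append])
    show "?R \<subseteq> ?L" using assms by (auto intro: zigzag_eq.refl)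
  qed
  then show ?thesis by (simp add: localization_def zigzag_class_def)
qed

end

text \<open>The canonical functor from \<open>C\<close> to its localization, on arrows.\<close>

definition loc_arr :: "('o, 'a, 'z) cat_scheme \<Rightarrow> 'a set \<Rightarrow> 'a \<Rightarrow> 'o \<times> 'a step list set \<times> 'o" where
  "loc_arr C W f = zigzag_class C W (Dom C f) [Fwd f] (Cod C f)"

context category
begin

lemma loc_arr_Hom:
  assumes "f \<in> Hom C a b"
  shows "loc_arr C W f \<in> Hom (localization C W) a b"
  using assms zigzag_single[OF assms]
  by (auto simp: loc_arr_def localization_def Hom_iff zigzag_class_def)

lemma loc_arr_eq_iff:
  assumes "f \<in> Hom C a b" "g \<in> Hom C a b"
  shows "loc_arr C W f = loc_arr C W g \<longleftrightarrow> zigzag_eq C W a b [Fwd f] [Fwd g]"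
  using zigzag_class_eq_iff[OF zigzag_single[OF assms(1)]] assms by (simp add: loc_arr_def Hom_iff)

lemma loc_arr_Comp:
  assumes f: "f \<in> Hom C a b" and g: "g \<in> Hom C b c"
  shows "loc_arr C W (Comp C g f) = Comp (localization C W) (loc_arr C W g) (loc_arr C W f)"
proof -
  have "zigzag C W a [Fwd f, Fwd g] c"
    using zigzag_append[OF zigzag_single[OF f] zigzag_single[OF g]] by simp
  then have "zigzag_class C W a [Fwd f, Fwd g] c = zigzag_class C W a [Fwd (Comp C g f)] c"
    using zigzag_class_eq_iff zigzag_eq.comp[OF f g] by blast
  then show ?thesis
    using localization_Comp[OF zigzag_single[OF f] zigzag_single[OF g]] Comp_in[OF f g] f g
    by (simp add: loc_arr_def Hom_iff)
qed

text \<open>\<open>p\<close> becomes invertible in the localization and can be cancelled on the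
  left.\<close>

lemma loc_arr_eq_of_retraction:
  assumes i: "i \<in> Hom C z k" "i' \<in> Hom C z k" and p: "p \<in> Hom C k z" "p \<in> W"
    and eq: "Comp C p i = Comp C p i'"
  shows "loc_arr C W i = loc_arr C W i'"
proof -
  \<comment> \<open>Inserting \<open>p\<close> and its formal inverse turns \<open>j\<close> into a
    zigzag that depends on \<open>j\<close> only through \<open>Comp C p j\<close>.\<close>
  have *: "zigzag_eq C W z k [Fwd j] [Fwd (Comp C p j), Bwd p]" if j: "j \<in> Hom C z k" for j
  proof -
    have 1: "zigzag_eq C W k k [] [Fwd p, Bwd p]"
      using p by (blast intro: zigzag_eq.inv1 zigzag_eq.sym)
    have 2: "zigzag C W z [Bwd p] k"
      using p Hom_Obj by (blast intro: zigzag.intros)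
    have 3: "zigzag_eq C W z k [Bwd p] [Bwd p]"
      using zigzag_eq.refl[OF 2] .
    have "zigzag_eq C W z k [Fwd j] [Fwd j, Fwd p, Bwd p]"
      using zigzag_eq_append[OF zigzag_eq.refl[OF zigzag_single[OF j]] 1] by simp
    moreover have "zigzag_eq C W z k [Fwd j, Fwd p, Bwd p] [Fwd (Comp C p j), Bwd p]"
      using zigzag_eq_append[OF zigzag_eq.comp[OF j p(1)] 3] by simp
    ultimately show ?thesis by (rule zigzag_eq.trans)
  qed
  show ?thesis
    using *[OF i(1)] *[OF i(2)] eq loc_arr_eq_iff[OF i] zigzag_eq.sym zigzag_eq.trans by metis
qed

end


section \<open>The homotopy category of the folk model structure\<close>

lemma Hom_Cat:
  "f \<in> Hom Cat A B \<longleftrightarrow> (\<exists>F. f = (A, F, B) \<and> small_category A \<and> small_category B \<and> is_functor F A B)"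
  by (auto simp: Cat_def Hom_iff)

lemma Obj_Cat: "A \<in> Obj Cat \<longleftrightarrow> small_category A"
  by (simp add: Cat_def)

lemma Comp_Cat: "Comp Cat (B, G, C) (A, F, B') = (A, comp_functor A G F, C)"
  by (simp add: Cat_def)

lemma Ide_Cat: "Ide Cat A = (A, id_functor A, A)"
  by (simp add: Cat_def)

lemma small_categoryD: "small_category A \<Longrightarrow> category A"
  by (simp add: small_category_def)

lemma category_Cat: "category Cat"
proof
  fix f g h :: "'a cat_arr" and A B C D
  assume f: "f \<in> Hom Cat A B"
  then show "Comp Cat f (Ide Cat A) = f" "Comp Cat (Ide Cat B) f = f"
    by (auto simp: Hom_Cat Ide_Cat Comp_Cat category.comp_functor_id category.comp_id_functor
        dest: small_categoryD)
  assume g: "g \<in> Hom Cat B C"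
  obtain F G where "f = (A, F, B)" "g = (B, G, C)" "small_category A" "small_category C"
    and F: "is_functor F A B" and G: "is_functor G B C"
    using f g by (auto simp: Hom_Cat)
  then show "Comp Cat g f \<in> Hom Cat A C"
    using category.is_functor_comp[OF small_categoryD F G] by (simp add: Hom_Cat Comp_Cat)
  assume h: "h \<in> Hom Cat C D"
  show "Comp Cat h (Comp Cat g f) = Comp Cat (Comp Cat h g) f"
    using f g h by (auto simp: Hom_Cat Comp_Cat category.comp_functor_assoc[OF small_categoryD])
next
  fix A :: "('a, 'a) cat"
  assume "A \<in> Obj Cat"
  then show "Ide Cat A \<in> Hom Cat A A"
    by (auto simp: Obj_Cat Hom_Cat Ide_Cat dest: small_categoryD intro: category.is_functor_id)
next
  fix f :: "'a cat_arr"
  assume "f \<in> Arr Cat"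
  then show "Dom Cat f \<in> Obj Cat" "Cod Cat f \<in> Obj Cat"
    by (auto simp: Cat_def)
qed

lemma folk_Cat_simps [simp]:
  "Obj (folk_Cat TYPE('u)) = Obj Cat" "Arr (folk_Cat TYPE('u)) = Arr Cat"
  "Dom (folk_Cat TYPE('u)) = Dom Cat" "Cod (folk_Cat TYPE('u)) = Cod Cat"
  "Ide (folk_Cat TYPE('u)) = Ide Cat" "Comp (folk_Cat TYPE('u)) = Comp Cat"
  "Weq (folk_Cat TYPE('u)) = equivalences"
  by (simp_all add: folk_Cat_def cat.extend_def)

lemma Hom_folk_Cat [simp]: "Hom (folk_Cat TYPE('u)) = Hom Cat"
  by (simp add: Hom_def fun_eq_iff)

lemma category_folk_Cat: "category (folk_Cat TYPE('u))"
  using category_Cat[where 'a = 'u] unfolding category_def by simp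

abbreviation zigzag_Cat ::
  "('u, 'u) cat \<Rightarrow> 'u cat_arr step list \<Rightarrow> ('u, 'u) cat \<Rightarrow> bool" where
  "zigzag_Cat \<equiv> zigzag (folk_Cat TYPE('u)) equivalences"

text \<open>A zigzag from \<open>A\<close> to \<open>B\<close> acts as a relation between the isomorphism classes of functors
  \<open>Z \<rightarrow> A\<close> and \<open>Z \<rightarrow> B\<close>; an equivalence acts as a bijection, so that this action descends to the
  homotopy category.\<close>

fun zigzag_act :: "('u, 'u) cat \<Rightarrow> ('u, 'u) cat \<Rightarrow> 'u cat_arr step list \<Rightarrow>
    ('u, 'u, 'u, 'u) funct \<Rightarrow> ('u, 'u, 'u, 'u) funct \<Rightarrow> bool" where
  "zigzag_act Z A [] S T = naturally_isomorphic Z A S T"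
| "zigzag_act Z A (Fwd (A', F, B) # p) S T = zigzag_act Z B p (comp_functor Z F S) T"
| "zigzag_act Z A (Bwd (B, F, A') # p) S T = (\<exists>R. is_functor R Z B \<and>
     naturally_isomorphic Z A (comp_functor Z F R) S \<and> zigzag_act Z B p R T)"

text \<open>The empty zigzag and the backward steps compare functors up to isomorphism, whereas
  forward steps compose strictly. Invariance in both arguments is what lets the action live on
  isomorphism classes.\<close>

lemma zigzag_act_iso:
  assumes "zigzag_Cat A p B" and Z: "category Z"
    and "is_functor S Z A" "is_functor S' Z A" "naturally_isomorphic Z A S S'"
    and "is_functor T Z B" "is_functor T' Z B" "naturally_isomorphic Z B T T'"
    and "zigzag_act Z A p S T"
  shows "zigzag_act Z A p S' T'"
  using assms(1,3-)
proof (induction arbitrary: S S' rule: zigzag.induct)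
  case (Nil A)
  then have "category A" by (simp add: Obj_Cat small_categoryD)
  note sym = natural_iso_sym[OF Z this] and trans = natural_iso_trans[OF Z this]
  have "naturally_isomorphic Z A S' S" using Nil sym by blast
  moreover have "naturally_isomorphic Z A S T" using Nil by simp
  ultimately show ?case using Nil trans by (metis zigzag_act.simps(1))
next
  case (Fwd f A B p C)
  then obtain F where f: "f = (A, F, B)" and AB: "category A" "category B" and F: "is_functor F A B"
    by (auto simp: Hom_Cat dest: small_categoryD)
  have "naturally_isomorphic Z B (comp_functor Z F S) (comp_functor Z F S')"
    using Fwd.prems natural_iso_whisker_left[OF Z AB _ _ F] by blast
  then show ?case
    using Fwd.IH[of "comp_functor Z F S" "comp_functor Z F S'"] Fwd.prems f
      category.is_functor_comp[OF Z _ F] by simp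
next
  case (Bwd f B A p C)
  then obtain F where f: "f = (B, F, A)" and AB: "category A" "category B" and F: "is_functor F B A"
    by (auto simp: Hom_Cat dest: small_categoryD)
  obtain R where R: "is_functor R Z B" "naturally_isomorphic Z A (comp_functor Z F R) S"
    "zigzag_act Z B p R T"
    using Bwd.prems f by auto
  have "naturally_isomorphic Z A (comp_functor Z F R) S'"
    using natural_iso_trans[OF Z AB(1) category.is_functor_comp[OF Z R(1) F] _ _ R(2)] Bwd.prems
    by blast
  moreover have "zigzag_act Z B p R T'"
    using Bwd.IH[of R R] R Bwd.prems natural_iso_refl[OF Z AB(2) R(1)] by simp
  ultimately show ?case using R(1) f by auto
qed

text \<open>Concatenation acts as composition of relations. The base case rests on invariance,
  because the empty zigzag relates \<open>S\<close> to every functor isomorphic to it.\<close>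

lemma zigzag_act_append:
  assumes "zigzag_Cat A p B" "zigzag_Cat B q C" and Z: "category Z"
    and "is_functor S Z A" and T: "is_functor T Z C"
  shows "zigzag_act Z A (p @ q) S T \<longleftrightarrow>
    (\<exists>R. is_functor R Z B \<and> zigzag_act Z A p S R \<and> zigzag_act Z B q R T)"
  using assms(1,2,4)
proof (induction arbitrary: S rule: zigzag.induct)
  case (Nil A)
  then have A: "category A" by (simp add: Obj_Cat small_categoryD)
  have "category C"
    using category.zigzag_Obj[OF category_folk_Cat Nil(2)] by (simp add: Obj_Cat small_categoryD)
  then have TT: "naturally_isomorphic Z C T T" using natural_iso_refl[OF Z] T by blast
  show ?case
  proof
    assume "zigzag_act Z A ([] @ q) S T"
    then show "\<exists>R. is_functor R Z A \<and> zigzag_act Z A [] S R \<and> zigzag_act Z A q R T"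
      using Nil natural_iso_refl[OF Z A] by auto
  next
    assume "\<exists>R. is_functor R Z A \<and> zigzag_act Z A [] S R \<and> zigzag_act Z A q R T"
    then show "zigzag_act Z A ([] @ q) S T"
      using Nil zigzag_act_iso[OF Nil(2) Z _ _ _ T T TT] natural_iso_sym[OF Z A] by auto
  qed
next
  case (Fwd f A B p C)
  then obtain F where "f = (A, F, B)" and F: "is_functor F A B"
    by (auto simp: Hom_Cat)
  then show ?case
    using Fwd.IH[of "comp_functor Z F S"] Fwd.prems category.is_functor_comp[OF Z _ F] by simp
next
  case (Bwd f B A p C)
  then obtain F where f: "f = (B, F, A)" by (auto simp: Hom_Cat)
  have "zigzag_act Z A ((Bwd f # p) @ q) S T \<longleftrightarrow> (\<exists>R'. is_functor R' Z B \<and>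
      naturally_isomorphic Z A (comp_functor Z F R') S \<and>
      (\<exists>R. is_functor R Z C \<and> zigzag_act Z B p R' R \<and> zigzag_act Z C q R T))"
    using Bwd.IH[OF Bwd.prems(1)] f by auto
  then show ?case using f by (simp only: zigzag_act.simps) blast
qed

lemma equivalencesD:
  "w \<in> equivalences \<Longrightarrow> w \<in> Hom Cat A B \<Longrightarrow> \<exists>F. w = (A, F, B) \<and> is_equivalence F A B \<and>
    is_functor F A B \<and> category A \<and> category B"
  by (auto simp: equivalences_def Hom_Cat dest: small_categoryD)

text \<open>Among the generating relations, \<open>ide\<close> and \<open>comp\<close> hold because
  composition of functors is strictly unital and associative; \<open>inv1\<close> needs that
  equivalences reflect isomorphism of functors, \<open>inv2\<close> that functors lift along them up
  to isomorphism.\<close>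

lemma zigzag_act_zigzag_eq:
  assumes "zigzag_eq (folk_Cat TYPE('u)) equivalences A B p q" and Z: "category Z"
    and "is_functor S Z A" "is_functor T Z B"
  shows "zigzag_act Z A p S T \<longleftrightarrow> zigzag_act Z A q S T"
  using assms(1,3,4)
proof (induction arbitrary: S T rule: zigzag_eq.induct)
  case (cong A p B C q q' r D)
  note app = zigzag_append and ok = category.zigzag_eq_zigzag[OF category_folk_Cat cong(2)]
  have "zigzag_act Z A (p @ x @ r) S T \<longleftrightarrow>
      (\<exists>R R'. is_functor R Z B \<and> is_functor R' Z C \<and>
        zigzag_act Z A p S R \<and> zigzag_act Z B x R R' \<and> zigzag_act Z C r R' T)"
    if x: "zigzag_Cat B x C" for x
  proof -
    have "zigzag_act Z A (p @ x @ r) S T \<longleftrightarrow>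
      (\<exists>R. is_functor R Z B \<and> zigzag_act Z A p S R \<and> zigzag_act Z B (x @ r) R T)"
      by (rule zigzag_act_append[OF cong(1) app[OF x cong(3)] Z cong(5,6)])
    then show ?thesis using zigzag_act_append[OF x cong(3) Z _ cong(6)] by blast
  qed
  then show ?case using ok cong(4) by blast
next
  case (ide A)
  then show ?case by (simp add: Ide_Cat category.comp_id_functor[OF Z])
next
  case (comp f A B g C)
  then obtain F G where "f = (A, F, B)" "g = (B, G, C)" by (auto simp: Hom_Cat)
  then show ?case
    using comp.prems by (simp add: Comp_Cat category.comp_functor_assoc[OF Z])
next
  case (inv1 w A B)
  then obtain F where w: "w = (A, F, B)" and F: "is_equivalence F A B" "is_functor F A B"
    and AB: "category A" "category B"
    using equivalencesD by (metis Hom_folk_Cat)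
  have "naturally_isomorphic Z A S T" if "is_functor R Z A"
    "naturally_isomorphic Z B (comp_functor Z F R) (comp_functor Z F S)"
    "naturally_isomorphic Z A R T" for R
    using equivalence_reflects_natural_iso[OF Z AB F(1) that(1) inv1(3) that(2)] that inv1
      natural_iso_trans[OF Z AB(1)] natural_iso_sym[OF Z AB(1)] by blast
  moreover have "naturally_isomorphic Z B (comp_functor Z F S) (comp_functor Z F S)"
    using natural_iso_refl[OF Z AB(2) category.is_functor_comp[OF Z inv1(3) F(2)]] .
  ultimately show ?case using w inv1(3) by auto
next
  case (inv2 w A B)
  then obtain F where w: "w = (A, F, B)" and F: "is_equivalence F A B" "is_functor F A B"
    and AB: "category A" "category B"
    using equivalencesD by (metis Hom_folk_Cat)
  have "naturally_isomorphic Z B S T" if R: "is_functor R Z A"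
    "naturally_isomorphic Z B (comp_functor Z F R) S"
    "naturally_isomorphic Z B (comp_functor Z F R) T" for R
    using natural_iso_trans[OF Z AB(2) inv2(3) _ inv2(4)] natural_iso_sym[OF Z AB(2) _ inv2(3) R(2)]
      category.is_functor_comp[OF Z R(1) F(2)] R(3) by blast
  moreover have "\<exists>R. is_functor R Z A \<and> naturally_isomorphic Z B (comp_functor Z F R) S \<and>
      naturally_isomorphic Z B (comp_functor Z F R) T" if "naturally_isomorphic Z B S T"
  proof -
    obtain R where R: "is_functor R Z A" "naturally_isomorphic Z B (comp_functor Z F R) S"
      using equivalence_lifts[OF Z AB(2) F(1) inv2(3)] by blast
    then show ?thesis
      using natural_iso_trans[OF Z AB(2) category.is_functor_comp[OF Z R(1) F(2)] inv2(3,4) R(2) that]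
      by blast
  qed
  ultimately show ?case using w by auto
qed auto

text \<open>The identity of \<open>Z\<close> serves as test functor: the zigzag of \<open>G\<close>
  relates it to \<open>G\<close>, hence so does the zigzag of \<open>F\<close>, and the latter means
  that \<open>F\<close> and \<open>G\<close> are isomorphic.\<close>

lemma natural_iso_of_loc_arr_eq:
  assumes ZY: "small_category Z" "small_category Y" and F: "is_functor F Z Y" and G: "is_functor G Z Y"
    and eq: "loc_arr (folk_Cat TYPE('u)) equivalences (Z, F, Y)
      = loc_arr (folk_Cat TYPE('u)) equivalences (Z, G, Y)"
  shows "naturally_isomorphic Z Y F G"
proof -
  note cat = small_categoryD[OF ZY(1)] small_categoryD[OF ZY(2)]
  have "zigzag_eq (folk_Cat TYPE('u)) equivalences Z Y [Fwd (Z, F, Y)] [Fwd (Z, G, Y)]"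
    using category.loc_arr_eq_iff[OF category_folk_Cat, of "(Z, F, Y)" Z Y "(Z, G, Y)"] eq ZY F G
    by (simp add: Hom_Cat)
  from zigzag_act_zigzag_eq[OF this cat(1) category.is_functor_id[OF cat(1)] G]
  have "naturally_isomorphic Z Y F G \<longleftrightarrow> naturally_isomorphic Z Y G G"
    by (simp add: category.comp_functor_id[OF cat(1) F] category.comp_functor_id[OF cat(1) G])
  then show ?thesis using natural_iso_refl[OF cat G] by blast
qed

section \<open>Small copies and cylinders\<close>

text \<open>The encoding \<open>E\<close> and the decoding \<open>D\<close> are strictly inverse,
  not only up to isomorphism, so that they cancel in composites by plain equations. Categories built
  on other types enter \<open>Cat\<close> in this way.\<close>

definition small_copy :: "('o, 'a) cat \<Rightarrow> ('u, 'u) cat \<Rightarrow> ('o, 'a, 'u, 'u) funct \<Rightarrow>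
    ('u, 'u, 'o, 'a) funct \<Rightarrow> bool" where
  "small_copy C S E D \<longleftrightarrow> small_category S \<and> is_functor E C S \<and> is_functor D S C \<and>
     comp_functor C D E = id_functor C \<and> comp_functor S E D = id_functor S"

text \<open>Injections of the objects and of the arrows into \<open>'u\<close> transport the whole
  structure.\<close>

lemma ex_small_copy:
  fixes C :: "('o, 'a) cat"
  assumes "category C" and small: "Obj C \<prec> (UNIV :: 'u set)" "Arr C \<prec> (UNIV :: 'u set)"
  shows "\<exists>(S :: ('u, 'u) cat) E D. small_copy C S E D"
proof -
  interpret C: category C by fact
  obtain io :: "'o \<Rightarrow> 'u" where io: "inj_on io (Obj C)"
    using small(1) unfolding lesspoll_def lepoll_def by blast
  obtain ia :: "'a \<Rightarrow> 'u" where ia: "inj_on ia (Arr C)"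
    using small(2) unfolding lesspoll_def lepoll_def by blast
  define jo where "jo = inv_into (Obj C) io"
  define ja where "ja = inv_into (Arr C) ia"
  have jo [simp]: "jo (io a) = a" if "a \<in> Obj C" for a
    using that io by (simp add: jo_def)
  have ja [simp]: "ja (ia f) = f" if "f \<in> Arr C" for f
    using that ia by (simp add: ja_def)
  \<comment> \<open>Outside the carriers, and on pairs that are not composable, the structure maps
    are \<open>undefined\<close>, as \<open>small_category\<close> demands.\<close>
  define S where "S = \<lparr>Obj = io ` Obj C, Arr = ia ` Arr C,
    Dom = restrict (\<lambda>x. io (Dom C (ja x))) (ia ` Arr C),
    Cod = restrict (\<lambda>x. io (Cod C (ja x))) (ia ` Arr C),
    Ide = restrict (\<lambda>x. ia (Ide C (jo x))) (io ` Obj C),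
    Comp = \<lambda>g f. if f \<in> ia ` Arr C \<and> g \<in> ia ` Arr C \<and> Cod C (ja f) = Dom C (ja g)
      then ia (Comp C (ja g) (ja f)) else undefined\<rparr>"
  have S_Ide: "Ide S (io a) = ia (Ide C a)" if "a \<in> Obj C" for a
    using that by (simp add: S_def)
  have S_Comp: "Comp S (ia g) (ia f) = ia (Comp C g f)" if "f \<in> Hom C a b" "g \<in> Hom C b c" for f g a b c
    using that by (auto simp: S_def Hom_iff)
  have S_HomI: "ia f \<in> Hom S (io a) (io b)" if "f \<in> Hom C a b" for f a b
    using that by (auto simp: S_def Hom_iff)
  have S_HomE: "\<exists>f a b. x = ia f \<and> p = io a \<and> q = io b \<and> f \<in> Hom C a b" if "x \<in> Hom S p q" for x p q
    using that by (auto simp: S_def Hom_iff)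
  \<comment> \<open>Injectivity of \<open>io\<close> ensures that composability in \<open>S\<close>
    means composability in \<open>C\<close>.\<close>
  have S_HomD: "\<exists>f. x = ia f \<and> f \<in> Hom C a b"
    if x: "x \<in> Hom S (io a) (io b)" and ab: "a \<in> Obj C" "b \<in> Obj C" for x a b
  proof -
    obtain f a' b' where f: "x = ia f" "io a = io a'" "io b = io b'" "f \<in> Hom C a' b'"
      using S_HomE[OF x] by blast
    then have "a' = a" "b' = b"
      using ab C.Hom_Obj[OF f(4)] io by (auto dest: inj_onD)
    then show ?thesis using f by blast
  qed
  have S_Obj: "Obj S = io ` Obj C" and S_Arr: "Arr S = ia ` Arr C" by (simp_all add: S_def)
  have S: "category S"
  proof
    fix x assume "x \<in> Arr S"
    then show "Dom S x \<in> Obj S" "Cod S x \<in> Obj S"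
      by (auto simp: S_def C.Dom_in C.Cod_in)
  next
    fix p assume "p \<in> Obj S"
    then show "Ide S p \<in> Hom S p p" using S_Ide S_HomI C.Ide_in by (auto simp: S_Obj)
  next
    fix x p q assume x: "x \<in> Hom S p q"
    obtain f a b where f: "x = ia f" "p = io a" "q = io b" "f \<in> Hom C a b"
      using S_HomE[OF x] by blast
    have ab: "a \<in> Obj C" "b \<in> Obj C" using C.Hom_Obj[OF f(4)] by auto
    show "Comp S x (Ide S p) = x" "Comp S (Ide S q) x = x"
      using f ab S_Ide S_Comp[OF C.Ide_in f(4)] S_Comp[OF f(4) C.Ide_in] C.Comp_Ide[OF f(4)]
        C.Ide_Comp[OF f(4)] by simp_all
    fix y r assume y: "y \<in> Hom S q r"
    obtain g c where g: "y = ia g" "r = io c" "g \<in> Hom C b c" and c: "c \<in> Obj C"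
      using S_HomE[OF y] S_HomD[of y b] y f(3) ab C.Hom_Obj by metis
    show "Comp S y x \<in> Hom S p r"
      using f g S_Comp[OF f(4) g(3)] S_HomI[OF C.Comp_in[OF f(4) g(3)]] by simp
    fix z s assume z: "z \<in> Hom S r s"
    obtain h d where h: "z = ia h" "h \<in> Hom C c d"
      using S_HomE[OF z] S_HomD[of z c] z g(2) c C.Hom_Obj by metis
    show "Comp S z (Comp S y x) = Comp S (Comp S z y) x"
      using f g h S_Comp[OF f(4) g(3)] S_Comp[OF g(3) h(2)] S_Comp[OF C.Comp_in[OF f(4) g(3)] h(2)]
        S_Comp[OF f(4) C.Comp_in[OF g(3) h(2)]] C.Comp_assoc[OF f(4) g(3) h(2)] by simp
  qed
  interpret S: category S by fact
  define E where "E = \<lparr>omap = restrict io (Obj C), amap = restrict ia (Arr C)\<rparr>"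
  define D where "D = \<lparr>omap = restrict jo (Obj S), amap = restrict ja (Arr S)\<rparr>"
  have E: "is_functor E C S"
  proof (rule is_functorI[OF assms(1)])
    fix f a b assume f: "f \<in> Hom C a b"
    then show "amap E f \<in> Hom S (omap E a) (omap E b)"
      using S_HomI[OF f] C.Hom_Obj[OF f] by (auto simp: E_def Hom_iff[of f])
    fix g c assume g: "g \<in> Hom C b c"
    show "amap E (Comp C g f) = Comp S (amap E g) (amap E f)"
      using f g S_Comp[OF f g] C.Comp_Arr[OF f g] by (simp add: E_def Hom_iff)
  qed (simp_all add: E_def S_Obj S_Ide)
  have D: "is_functor D S C"
  proof (rule is_functorI[OF S])
    fix x p q assume x: "x \<in> Hom S p q"
    obtain f a b where f: "x = ia f" "p = io a" "q = io b" "f \<in> Hom C a b"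
      using S_HomE[OF x] by blast
    have ab: "a \<in> Obj C" "b \<in> Obj C" "f \<in> Arr C" using f(4) C.Hom_Obj[OF f(4)] by (auto simp: Hom_iff)
    then show "amap D x \<in> Hom C (omap D p) (omap D q)"
      using f by (auto simp: D_def S_Obj S_Arr)
    fix y r assume y: "y \<in> Hom S q r"
    obtain g c where g: "y = ia g" "r = io c" "g \<in> Hom C b c"
      using S_HomE[OF y] S_HomD[of y b] y f(3) ab C.Hom_Obj by metis
    then show "amap D (Comp S y x) = Comp C (amap D y) (amap D x)"
      using f ab S_Comp[OF f(4) g(3)] C.Comp_Arr[OF f(4) g(3)]
      by (auto simp: D_def S_Arr Hom_iff)
  next
    fix p assume "p \<in> Obj S"
    then obtain a where "p = io a" "a \<in> Obj C" by (auto simp: S_Obj)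
    then show "omap D p \<in> Obj C" "amap D (Ide S p) = Ide C (omap D p)"
      by (simp_all add: D_def S_Obj S_Arr S_Ide)
  qed (simp_all add: D_def)
  have "small_category S"
    using S image_lesspoll[OF small(1), of io] image_lesspoll[OF small(2), of ia]
    unfolding small_category_def small_def by (auto simp: S_def)
  moreover have "comp_functor C D E = id_functor C" "comp_functor S E D = id_functor S"
    by (auto simp: comp_functor_def id_functor_def D_def E_def S_Obj S_Arr restrict_def fun_eq_iff)
  ultimately show ?thesis using E D unfolding small_copy_def by blast
qed

text \<open>The product of \<open>Z\<close> with the category that has two objects and exactly one
  arrow between any two of them; the pair of ends (s, t) records the arrow of the second
  factor.\<close>

definition cylinder :: "('o, 'a) cat \<Rightarrow> ('o \<times> bool, 'a \<times> bool \<times> bool) cat" where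
  "cylinder Z =
     \<lparr>Obj = Obj Z \<times> UNIV,
      Arr = Arr Z \<times> UNIV,
      Dom = (\<lambda>(f, s, t). (Dom Z f, s)),
      Cod = (\<lambda>(f, s, t). (Cod Z f, t)),
      Ide = (\<lambda>(a, s). (Ide Z a, s, s)),
      Comp = (\<lambda>(g, s', t') (f, s, t). (Comp Z g f, s, t'))\<rparr>"

definition cylinder_in :: "('o, 'a) cat \<Rightarrow> bool \<Rightarrow> ('o, 'a, 'o \<times> bool, 'a \<times> bool \<times> bool) funct" where
  "cylinder_in Z s = \<lparr>omap = restrict (\<lambda>a. (a, s)) (Obj Z), amap = restrict (\<lambda>f. (f, s, s)) (Arr Z)\<rparr>"

definition cylinder_pr :: "('o, 'a) cat \<Rightarrow> ('o \<times> bool, 'a \<times> bool \<times> bool, 'o, 'a) funct" where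
  "cylinder_pr Z = \<lparr>omap = restrict fst (Obj Z \<times> UNIV), amap = restrict fst (Arr Z \<times> UNIV)\<rparr>"

lemma Hom_cylinder:
  "x \<in> Hom (cylinder Z) p q \<longleftrightarrow>
    (\<exists>f a b s t. x = (f, s, t) \<and> p = (a, s) \<and> q = (b, t) \<and> f \<in> Hom Z a b)"
  by (cases x) (auto simp: cylinder_def Hom_iff)

lemma Comp_cylinder [simp]: "Comp (cylinder Z) (g, s', t') (f, s, t) = (Comp Z g f, s, t')"
  by (simp add: cylinder_def)

lemma Ide_cylinder [simp]: "Ide (cylinder Z) (a, s) = (Ide Z a, s, s)"
  by (simp add: cylinder_def)

lemma category_cylinder:
  assumes "category Z"
  shows "category (cylinder Z)"
proof -
  interpret Z: category Z by fact
  show ?thesis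
  proof
    fix x p q assume x: "x \<in> Hom (cylinder Z) p q"
    then show "Comp (cylinder Z) x (Ide (cylinder Z) p) = x"
      "Comp (cylinder Z) (Ide (cylinder Z) q) x = x"
      by (auto simp: Hom_cylinder Z.Comp_Ide Z.Ide_Comp)
    fix y r assume y: "y \<in> Hom (cylinder Z) q r"
    then show "Comp (cylinder Z) y x \<in> Hom (cylinder Z) p r"
      using x by (auto simp: Hom_cylinder intro: Z.Comp_in)
    fix z s assume "z \<in> Hom (cylinder Z) r s"
    then show "Comp (cylinder Z) z (Comp (cylinder Z) y x)
        = Comp (cylinder Z) (Comp (cylinder Z) z y) x"
      using x y by (auto simp: Hom_cylinder intro: Z.Comp_assoc)
  next
    fix p assume "p \<in> Obj (cylinder Z)"
    then obtain a s where "p = (a, s)" "a \<in> Obj Z" by (auto simp: cylinder_def)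
    then show "Ide (cylinder Z) p \<in> Hom (cylinder Z) p p"
      using Z.Ide_in by (auto simp: Hom_cylinder)
  qed (auto simp: cylinder_def Z.Dom_in Z.Cod_in)
qed

lemma is_functor_cylinder_in:
  assumes "category Z"
  shows "is_functor (cylinder_in Z s) Z (cylinder Z)"
proof -
  interpret Z: category Z by fact
  show ?thesis
    by (rule is_functorI[OF assms])
      (auto simp: cylinder_in_def Hom_cylinder Z.Comp_Arr dest: Z.Hom_Obj,
        auto simp: cylinder_def Hom_iff Z.Dom_in Z.Cod_in)
qed

lemma is_functor_cylinder_pr:
  assumes "category Z"
  shows "is_functor (cylinder_pr Z) (cylinder Z) Z"
proof -
  interpret Z: category Z by fact
  show ?thesis
    by (rule is_functorI[OF category_cylinder[OF assms]])
      (auto simp: cylinder_pr_def Hom_cylinder Z.Comp_Arr dest: Z.Hom_Obj,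
        auto simp: cylinder_def Hom_iff Z.Dom_in Z.Cod_in)
qed

lemma cylinder_pr_in:
  "comp_functor Z (cylinder_pr Z) (cylinder_in Z s) = id_functor Z"
  by (auto simp: comp_functor_def id_functor_def cylinder_pr_def cylinder_in_def restrict_def)

text \<open>The component at (a, t) is the identity of a, read as an arrow from the end
  \<open>s\<close> to the end t; exchanging the ends inverts it. Together with
  \<open>cylinder_pr_in\<close> this makes the projection an equivalence.\<close>

lemma cylinder_in_pr:
  assumes "category Z"
  shows "naturally_isomorphic (cylinder Z) (cylinder Z)
    (comp_functor (cylinder Z) (cylinder_in Z s) (cylinder_pr Z)) (id_functor (cylinder Z))"
proof -
  interpret Z: category Z by fact
  interpret K: category "cylinder Z" by (rule category_cylinder[OF assms])
  have o: "omap (comp_functor (cylinder Z) (cylinder_in Z s) (cylinder_pr Z)) (a, t) = (a, s)"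
    "omap (id_functor (cylinder Z)) (a, t) = (a, t)" if "a \<in> Obj Z" for a t
    using that by (auto simp: comp_functor_def id_functor_def cylinder_pr_def cylinder_in_def cylinder_def)
  have m: "amap (comp_functor (cylinder Z) (cylinder_in Z s) (cylinder_pr Z)) (f, t, t') = (f, s, s)"
    "amap (id_functor (cylinder Z)) (f, t, t') = (f, t, t')" if "f \<in> Arr Z" for f t t'
    using that by (auto simp: comp_functor_def id_functor_def cylinder_pr_def cylinder_in_def cylinder_def)
  have iso: "iso_arr (cylinder Z) (Ide Z a, s, t)" if a: "a \<in> Obj Z" for a t
  proof -
    have 1: "(Ide Z a, s, t) \<in> Hom (cylinder Z) (a, s) (a, t)"
      "(Ide Z a, t, s) \<in> Hom (cylinder Z) (a, t) (a, s)"
      using Z.Ide_in[OF a] by (auto simp: Hom_cylinder)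
    show ?thesis
      unfolding K.iso_arr_iff[OF 1(1)] using 1(2) Z.Ide_Comp[OF Z.Ide_in[OF a]]
      by (intro bexI[of _ "(Ide Z a, t, s)"]) auto
  qed
  have nat: "Comp Z (Ide Z (Cod Z f)) f = f" "Comp Z f (Ide Z (Dom Z f)) = f" if "f \<in> Arr Z" for f
    using Z.Ide_Comp[OF Z.Arr_Hom[OF that]] Z.Comp_Ide[OF Z.Arr_Hom[OF that]] by auto
  show ?thesis
    unfolding naturally_isomorphic_def
  proof (intro exI[of _ "\<lambda>(a, t). (Ide Z a, s, t)"] conjI ballI)
    fix x assume "x \<in> Obj (cylinder Z)"
    then obtain a t where x: "x = (a, t)" and a: "a \<in> Obj Z" by (auto simp: cylinder_def)
    show "(case x of (a, t) \<Rightarrow> (Ide Z a, s, t)) \<in> Hom (cylinder Z)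
        (omap (comp_functor (cylinder Z) (cylinder_in Z s) (cylinder_pr Z)) x)
        (omap (id_functor (cylinder Z)) x)"
      using Z.Ide_in[OF a] unfolding x o[OF a] by (auto simp: Hom_cylinder)
    show "iso_arr (cylinder Z) (case x of (a, t) \<Rightarrow> (Ide Z a, s, t))"
      using iso[OF a] x by simp
  next
    fix x assume "x \<in> Arr (cylinder Z)"
    then obtain f t t' where x: "x = (f, t, t')" and f: "f \<in> Arr Z" by (auto simp: cylinder_def)
    have dc: "Dom (cylinder Z) x = (Dom Z f, t)" "Cod (cylinder Z) x = (Cod Z f, t')"
      by (simp_all add: x cylinder_def)
    show "Comp (cylinder Z) (case Cod (cylinder Z) x of (a, t) \<Rightarrow> (Ide Z a, s, t))
        (amap (comp_functor (cylinder Z) (cylinder_in Z s) (cylinder_pr Z)) x)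
      = Comp (cylinder Z) (amap (id_functor (cylinder Z)) x)
        (case Dom (cylinder Z) x of (a, t) \<Rightarrow> (Ide Z a, s, t))"
      unfolding dc unfolding x m[OF f] using nat[OF f] by simp
  qed
qed

text \<open>With \<open>\<phi>\<close> the given isomorphism at the end \<open>True\<close> and the identity at the end \<open>False\<close>, the
  functor sends \<open>(f, s, t)\<close> to the conjugate \<open>\<phi> t \<circ> F f \<circ> (\<phi> s)\<inverse>\<close>.\<close>

lemma natural_iso_cylinder:
  assumes "category Z" "category Y" and F: "is_functor F Z Y" and G: "is_functor G Z Y"
    and "naturally_isomorphic Z Y F G"
  obtains H where "is_functor H (cylinder Z) Y"
    "comp_functor Z H (cylinder_in Z False) = F" "comp_functor Z H (cylinder_in Z True) = G"
proof -
  interpret Z: category Z by fact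
  interpret Y: category Y by fact
  obtain \<eta> where \<eta>: "\<And>a. a \<in> Obj Z \<Longrightarrow> \<eta> a \<in> Hom Y (omap F a) (omap G a)"
    "\<And>a. a \<in> Obj Z \<Longrightarrow> iso_arr Y (\<eta> a)"
    and nat: "\<And>f. f \<in> Arr Z \<Longrightarrow>
      Comp Y (\<eta> (Cod Z f)) (amap F f) = Comp Y (amap G f) (\<eta> (Dom Z f))"
    using assms(5) unfolding naturally_isomorphic_def by blast
  have "\<forall>a\<in>Obj Z. \<exists>t. t \<in> Hom Y (omap G a) (omap F a) \<and>
      Comp Y t (\<eta> a) = Ide Y (omap F a) \<and> Comp Y (\<eta> a) t = Ide Y (omap G a)"
    using \<eta> Y.iso_arr_iff by blast
  then obtain \<theta> where \<theta>: "\<And>a. a \<in> Obj Z \<Longrightarrow> \<theta> a \<in> Hom Y (omap G a) (omap F a)"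
      "\<And>a. a \<in> Obj Z \<Longrightarrow> Comp Y (\<theta> a) (\<eta> a) = Ide Y (omap F a)"
      "\<And>a. a \<in> Obj Z \<Longrightarrow> Comp Y (\<eta> a) (\<theta> a) = Ide Y (omap G a)"
    by metis
  define V where "V a s = (if s then omap G a else omap F a)" for a s
  define \<phi> where "\<phi> a s = (if s then \<eta> a else Ide Y (omap F a))" for a s
  define \<psi> where "\<psi> a s = (if s then \<theta> a else Ide Y (omap F a))" for a s
  have FV: "omap F a \<in> Obj Y" "V a s \<in> Obj Y" if "a \<in> Obj Z" for a s
    using that functor_omap[OF F] functor_omap[OF G] by (auto simp: V_def)
  have \<phi>: "\<phi> a s \<in> Hom Y (omap F a) (V a s)" and \<psi>: "\<psi> a s \<in> Hom Y (V a s) (omap F a)"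
    and \<psi>\<phi>: "Comp Y (\<psi> a s) (\<phi> a s) = Ide Y (omap F a)"
    and \<phi>\<psi>: "Comp Y (\<phi> a s) (\<psi> a s) = Ide Y (V a s)" if "a \<in> Obj Z" for a s
    using \<eta>(1)[OF that] \<theta>[OF that] FV[OF that] Y.Ide_in Y.Ide_Comp[OF Y.Ide_in[OF FV(1)[OF that]]]
    by (auto simp: V_def \<phi>_def \<psi>_def)
  define h where "h f s t = Comp Y (\<phi> (Cod Z f) t) (Comp Y (amap F f) (\<psi> (Dom Z f) s))" for f s t
  have h: "h f s t \<in> Hom Y (V a s) (V b t)" if f: "f \<in> Hom Z a b" for f s t a b
    using f Z.Hom_Obj[OF f] Y.Comp_in[OF Y.Comp_in[OF \<psi> functor_Hom[OF F f]] \<phi>]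
    by (simp add: h_def Hom_iff[of f])
  \<comment> \<open>Consecutive conjugates meet in \<open>\<psi> b t\<close> after
    \<open>\<phi> b t\<close>, which cancels at either end \<open>t\<close>.\<close>
  have h_comp: "h (Comp Z g f) s u = Comp Y (h g t u) (h f s t)"
    if f: "f \<in> Hom Z a b" and g: "g \<in> Hom Z b c" for f g a b c s t u
  proof -
    have ob: "a \<in> Obj Z" "b \<in> Obj Z" "c \<in> Obj Z" using Z.Hom_Obj[OF f] Z.Hom_Obj[OF g] by auto
    note Ff = functor_Hom[OF F f] and Fg = functor_Hom[OF F g]
    let ?f = "Comp Y (amap F f) (\<psi> a s)"
    have f': "?f \<in> Hom Y (V a s) (omap F b)" by (rule Y.Comp_in[OF \<psi>[OF ob(1)] Ff])
    have 1: "Comp Y (\<psi> b t) (Comp Y (\<phi> b t) ?f) = ?f"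
      using Y.Comp_assoc[OF f' \<phi>[OF ob(2)] \<psi>[OF ob(2)]] \<psi>\<phi>[OF ob(2)] Y.Ide_Comp[OF f'] by simp
    have 2: "Comp Y (\<phi> b t) ?f \<in> Hom Y (V a s) (V b t)"
      by (rule Y.Comp_in[OF f' \<phi>[OF ob(2)]])
    have "Comp Y (h g t u) (h f s t)
        = Comp Y (Comp Y (\<phi> c u) (Comp Y (amap F g) (\<psi> b t))) (Comp Y (\<phi> b t) ?f)"
      using f g by (simp add: h_def Hom_iff)
    also have "\<dots> = Comp Y (\<phi> c u) (Comp Y (Comp Y (amap F g) (\<psi> b t)) (Comp Y (\<phi> b t) ?f))"
      using Y.Comp_assoc[OF 2 Y.Comp_in[OF \<psi>[OF ob(2)] Fg] \<phi>[OF ob(3)]] by simp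
    also have "\<dots> = Comp Y (\<phi> c u) (Comp Y (amap F g) ?f)"
      using Y.Comp_assoc[OF 2 \<psi>[OF ob(2)] Fg] 1 by simp
    also have "\<dots> = Comp Y (\<phi> c u) (Comp Y (amap F (Comp Z g f)) (\<psi> a s))"
      using Y.Comp_assoc[OF \<psi>[OF ob(1)] Ff Fg] functor_Comp[OF F f g] by simp
    also have "\<dots> = h (Comp Z g f) s u"
      using Z.Comp_in[OF f g] by (simp add: h_def Hom_iff)
    finally show ?thesis by simp
  qed
  define H where "H = \<lparr>omap = restrict (\<lambda>(a, s). V a s) (Obj (cylinder Z)),
    amap = restrict (\<lambda>(f, s, t). h f s t) (Arr (cylinder Z))\<rparr>"
  have H_o: "omap H (a, s) = V a s" if "a \<in> Obj Z" for a s
    using that by (simp add: H_def cylinder_def)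
  have H_a: "amap H (f, s, t) = h f s t" if "f \<in> Arr Z" for f s t
    using that by (simp add: H_def cylinder_def)
  have H: "is_functor H (cylinder Z) Y"
  proof (rule is_functorI[OF category_cylinder[OF assms(1)]])
    fix x assume "x \<in> Obj (cylinder Z)"
    then obtain a s where x: "x = (a, s)" and a: "a \<in> Obj Z" by (auto simp: cylinder_def)
    show "omap H x \<in> Obj Y" using x a FV H_o by simp
    have "amap H (Ide (cylinder Z) x) = Comp Y (\<phi> a s) (Comp Y (Ide Y (omap F a)) (\<psi> a s))"
      using x a H_a Z.Ide_in[OF a] functor_Ide[OF F a] by (simp add: h_def Hom_iff)
    then show "amap H (Ide (cylinder Z) x) = Ide Y (omap H x)"
      using x a H_o \<phi>\<psi>[OF a] Y.Ide_Comp[OF \<psi>[OF a]] by simp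
  next
    fix x p q assume x: "x \<in> Hom (cylinder Z) p q"
    then obtain f a b s t where f: "x = (f, s, t)" "p = (a, s)" "q = (b, t)" "f \<in> Hom Z a b"
      by (auto simp: Hom_cylinder)
    show "amap H x \<in> Hom Y (omap H p) (omap H q)"
      using f H_a H_o h[OF f(4)] Z.Hom_Obj[OF f(4)] by (simp add: Hom_iff[of f])
    fix y r assume y: "y \<in> Hom (cylinder Z) q r"
    then obtain g c u where g: "y = (g, t, u)" "r = (c, u)" "g \<in> Hom Z b c"
      using f by (auto simp: Hom_cylinder)
    show "amap H (Comp (cylinder Z) y x) = Comp Y (amap H y) (amap H x)"
      using f g H_a h_comp[OF f(4) g(3)] Z.Comp_in[OF f(4) g(3)] by (simp add: Hom_iff)
  qed (simp_all add: H_def)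
  have hF: "h f False False = amap F f" and hG: "h f True True = amap G f" if f: "f \<in> Arr Z" for f
  proof -
    note ob = Z.Dom_in[OF f] Z.Cod_in[OF f]
    note Ff = functor_Hom[OF F Z.Arr_Hom[OF f]] and Gf = functor_Hom[OF G Z.Arr_Hom[OF f]]
    show "h f False False = amap F f"
      using Y.Ide_Comp[OF Ff] Y.Comp_Ide[OF Ff] by (simp add: h_def \<phi>_def \<psi>_def)
    have "h f True True = Comp Y (Comp Y (\<eta> (Cod Z f)) (amap F f)) (\<theta> (Dom Z f))"
      using Y.Comp_assoc[OF \<theta>(1)[OF ob(1)] Ff \<eta>(1)[OF ob(2)]] by (simp add: h_def \<phi>_def \<psi>_def)
    also have "\<dots> = amap G f"
      using nat[OF f] Y.Comp_assoc[OF \<theta>(1)[OF ob(1)] \<eta>(1)[OF ob(1)] Gf] \<theta>(3)[OF ob(1)]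
        Y.Comp_Ide[OF Gf] by simp
    finally show "h f True True = amap G f" .
  qed
  have "comp_functor Z H (cylinder_in Z False) = F"
    by (rule functor_eqI[OF Z.is_functor_comp[OF is_functor_cylinder_in[OF assms(1)] H] F])
      (simp_all add: cylinder_in_def H_o H_a hF V_def)
  moreover have "comp_functor Z H (cylinder_in Z True) = G"
    by (rule functor_eqI[OF Z.is_functor_comp[OF is_functor_cylinder_in[OF assms(1)] H] G])
      (simp_all add: cylinder_in_def H_o H_a hG V_def)
  ultimately show ?thesis using that H by blast
qed

text \<open>Both ends of the cylinder are sections of the projection, an equivalence, so they
  coincide in the localization; composing with the functor that the isomorphism induces on the
  cylinder gives the claim. As \<open>'u\<close> is infinite, the cylinder has a small copy
  \<open>K\<close>.\<close>

lemma loc_arr_eq_of_natural_iso: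
  assumes inf: "infinite (UNIV :: 'u set)"
    and Z: "small_category Z" and Y: "small_category Y"
    and F: "is_functor F Z Y" and G: "is_functor G Z Y"
    and iso: "naturally_isomorphic Z Y F G"
  shows "loc_arr (folk_Cat TYPE('u)) equivalences (Z, F, Y)
      = loc_arr (folk_Cat TYPE('u)) equivalences (Z, G, Y)"
proof -
  note ZY = small_categoryD[OF Z] small_categoryD[OF Y]
  interpret Z: category Z by (rule ZY)
  interpret cyl: category "cylinder Z" by (rule category_cylinder[OF ZY(1)])
  interpret M: category "folk_Cat TYPE('u)" by (rule category_folk_Cat)
  have fin: "(UNIV :: bool set) \<prec> (UNIV :: 'u set)" "(UNIV :: (bool \<times> bool) set) \<prec> (UNIV :: 'u set)"
    using inf by (simp_all add: finite_lesspoll_infinite)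
  have "Obj Z \<prec> (UNIV :: 'u set)" "Arr Z \<prec> (UNIV :: 'u set)"
    using Z by (simp_all add: small_category_def small_def)
  then have "Obj (cylinder Z) \<prec> (UNIV :: 'u set)" "Arr (cylinder Z) \<prec> (UNIV :: 'u set)"
    using Times_lesspoll_infinite[OF inf] fin by (simp_all add: cylinder_def)
  then obtain K :: "('u, 'u) cat" and E D where "small_copy (cylinder Z) K E D"
    using ex_small_copy[OF cyl.category_axioms] by blast
  then have K: "small_category K"
    and E: "is_functor E (cylinder Z) K" and D: "is_functor D K (cylinder Z)"
    and DE: "comp_functor (cylinder Z) D E = id_functor (cylinder Z)"
    and ED: "comp_functor K E D = id_functor K"
    by (simp_all add: small_copy_def)
  interpret K: category K by (rule small_categoryD[OF K])
  obtain H where H: "is_functor H (cylinder Z) Y"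
    and HF: "comp_functor Z H (cylinder_in Z False) = F"
    and HG: "comp_functor Z H (cylinder_in Z True) = G"
    using natural_iso_cylinder[OF ZY F G iso] .
  note I = is_functor_cylinder_in[OF ZY(1)] and P = is_functor_cylinder_pr[OF ZY(1)]
  define i where "i s = comp_functor Z E (cylinder_in Z s)" for s
  define p where "p = comp_functor K (cylinder_pr Z) D"
  define H' where "H' = comp_functor K H D"
  have i: "is_functor (i s) Z K" for s unfolding i_def by (rule Z.is_functor_comp[OF I E])
  have p: "is_functor p K Z" unfolding p_def by (rule K.is_functor_comp[OF D P])
  have H': "is_functor H' K Y" unfolding H'_def by (rule K.is_functor_comp[OF D H])
  have Di: "comp_functor Z D (i s) = cylinder_in Z s" for s
    unfolding i_def by (simp add: Z.comp_functor_assoc[OF I] DE Z.comp_id_functor[OF I])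
  have pi: "comp_functor Z p (i s) = id_functor Z" for s
    unfolding p_def Z.comp_functor_assoc[OF i, symmetric] Di by (rule cylinder_pr_in)
  have H'i: "comp_functor Z H' (i s) = comp_functor Z H (cylinder_in Z s)" for s
    unfolding H'_def Z.comp_functor_assoc[OF i, symmetric] Di ..
  \<comment> \<open>\<open>?R\<close> collapses the cylinder onto its end \<open>False\<close>. Its
    isomorphism with the identity, transported along \<open>D\<close> and \<open>E\<close>, exhibits
    \<open>i False\<close> as a quasi-inverse of \<open>p\<close>.\<close>
  let ?R = "comp_functor (cylinder Z) (cylinder_in Z False) (cylinder_pr Z)"
  have R: "is_functor ?R (cylinder Z) (cylinder Z)" by (rule cyl.is_functor_comp[OF P I])
  have "naturally_isomorphic K (cylinder Z) (comp_functor K ?R D)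
      (comp_functor K (id_functor (cylinder Z)) D)"
    by (rule natural_iso_whisker_right[OF K.category_axioms R cyl.is_functor_id D
          cylinder_in_pr[OF ZY(1)]])
  then have "naturally_isomorphic K K (comp_functor K E (comp_functor K ?R D)) (comp_functor K E D)"
    using natural_iso_whisker_left[OF K.category_axioms cyl.category_axioms K.category_axioms
        K.is_functor_comp[OF D R] D E] K.comp_id_functor[OF D] by simp
  moreover have "comp_functor K E (comp_functor K ?R D) = comp_functor K (i False) p"
    unfolding i_def p_def
    by (simp add: K.comp_functor_assoc[OF D] K.comp_functor_assoc[OF K.is_functor_comp[OF D P], symmetric]
        cyl.comp_functor_assoc[OF P])
  ultimately have "naturally_isomorphic K K (comp_functor K (i False) p) (id_functor K)"
    using ED by simp
  moreover have "naturally_isomorphic Z Z (comp_functor Z p (i False)) (id_functor Z)"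
    unfolding pi by (rule natural_iso_refl[OF ZY(1,1) Z.is_functor_id])
  ultimately have "is_equivalence p K Z"
    unfolding is_equivalence_def using p i by blast
  then have pW: "(K, p, Z) \<in> equivalences"
    using K Z p by (simp add: equivalences_def Cat_def)
  have hom: "(Z, i s, K) \<in> Hom (folk_Cat TYPE('u)) Z K" "(K, p, Z) \<in> Hom (folk_Cat TYPE('u)) K Z"
    "(K, H', Y) \<in> Hom (folk_Cat TYPE('u)) K Y" for s
    using K Z Y i p H' by (simp_all add: Hom_Cat)
  have "loc_arr (folk_Cat TYPE('u)) equivalences (Z, i False, K)
      = loc_arr (folk_Cat TYPE('u)) equivalences (Z, i True, K)"
    by (rule M.loc_arr_eq_of_retraction[OF hom(1,1,2) pW]) (simp add: Comp_Cat pi)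
  then show ?thesis
    using M.loc_arr_Comp[OF hom(1,3), of equivalences False] M.loc_arr_Comp[OF hom(1,3), of equivalences True]
    by (simp add: Comp_Cat H'i HF HG)
qed

section \<open>Two families of categories\<close>

text \<open>The free category on a quiver in which no two edges are composable.\<close>

definition quiver :: "'v set \<Rightarrow> 'e set \<Rightarrow> ('e \<Rightarrow> 'v) \<Rightarrow> ('e \<Rightarrow> 'v) \<Rightarrow> ('v, 'v + 'e) cat" where
  "quiver V E s t =
     \<lparr>Obj = V, Arr = V <+> E, Dom = case_sum (\<lambda>v. v) s, Cod = case_sum (\<lambda>v. v) t, Ide = Inl,
      Comp = (\<lambda>g f. case f of Inl _ \<Rightarrow> g | Inr _ \<Rightarrow> f)\<rparr>"

locale bipartite_quiver =
  fixes V :: "'v set" and E :: "'e set" and s t :: "'e \<Rightarrow> 'v"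
  assumes source: "e \<in> E \<Longrightarrow> s e \<in> V" and target: "e \<in> E \<Longrightarrow> t e \<in> V"
    and not_composable: "e \<in> E \<Longrightarrow> e' \<in> E \<Longrightarrow> t e \<noteq> s e'"
begin

abbreviation Q where "Q \<equiv> quiver V E s t"

lemma Obj_Q: "Obj Q = V" and Arr_Q: "Arr Q = V <+> E" and Ide_Q: "Ide Q = Inl"
  and Inr_Hom: "e \<in> E \<Longrightarrow> Inr e \<in> Hom Q (s e) (t e)"
  by (auto simp: quiver_def Hom_iff)

lemma Hom_Q:
  "x \<in> Hom Q a b \<longleftrightarrow> (a = b \<and> a \<in> V \<and> x = Inl a) \<or> (\<exists>e\<in>E. x = Inr e \<and> a = s e \<and> b = t e)"
  by (auto simp: quiver_def Hom_iff)

lemma Comp_Q: "Comp Q g (Inl a) = g" "Comp Q g (Inr e) = Inr e"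
  by (simp_all add: quiver_def)

lemma category_quiver: "category Q"
proof
  fix f assume "f \<in> Arr Q"
  then show "Dom Q f \<in> Obj Q" "Cod Q f \<in> Obj Q"
    using source target by (auto simp: quiver_def)
next
  fix f g h a b c d assume f: "f \<in> Hom Q a b"
  then show "Comp Q f (Ide Q a) = f" "Comp Q (Ide Q b) f = f"
    by (auto simp: Hom_Q Ide_Q Comp_Q)
  assume g: "g \<in> Hom Q b c"
  show "Comp Q g f \<in> Hom Q a c"
    using f g not_composable by (auto simp: Hom_Q Comp_Q)
  assume h: "h \<in> Hom Q c d"
  show "Comp Q h (Comp Q g f) = Comp Q (Comp Q h g) f"
    using f g h by (auto simp: Hom_Q Comp_Q)
qed (simp add: Hom_Q Ide_Q Obj_Q)

text \<open>The universal property of the free category.\<close>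

definition lift :: "('p, 'b) cat \<Rightarrow> ('v \<Rightarrow> 'p) \<Rightarrow> ('e \<Rightarrow> 'b) \<Rightarrow> ('v, 'v + 'e, 'p, 'b) funct" where
  "lift D fo fe = \<lparr>omap = restrict fo V, amap = restrict (case_sum (\<lambda>v. Ide D (fo v)) fe) (V <+> E)\<rparr>"

lemma omap_lift [simp]: "v \<in> V \<Longrightarrow> omap (lift D fo fe) v = fo v"
  and amap_lift [simp]: "v \<in> V \<Longrightarrow> amap (lift D fo fe) (Inl v) = Ide D (fo v)"
    "e \<in> E \<Longrightarrow> amap (lift D fo fe) (Inr e) = fe e"
  by (auto simp: lift_def)

lemma is_functor_lift:
  assumes "category D" "\<And>v. v \<in> V \<Longrightarrow> fo v \<in> Obj D"
    and fe: "\<And>e. e \<in> E \<Longrightarrow> fe e \<in> Hom D (fo (s e)) (fo (t e))"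
  shows "is_functor (lift D fo fe) Q D"
proof -
  interpret D: category D by fact
  show ?thesis
  proof (rule is_functorI[OF category_quiver])
    fix f g a b c assume f: "f \<in> Hom Q a b"
    then show "amap (lift D fo fe) f \<in> Hom D (omap (lift D fo fe) a) (omap (lift D fo fe) b)"
      using assms D.Ide_in source target by (auto simp: Hom_Q)
    assume g: "g \<in> Hom Q b c"
    show "amap (lift D fo fe) (Comp Q g f)
        = Comp D (amap (lift D fo fe) g) (amap (lift D fo fe) f)"
      using f g assms(2) not_composable D.Comp_Ide[OF fe] D.Ide_Comp[OF fe]
        D.Ide_Comp[OF D.Ide_in] by (auto simp: Hom_Q Comp_Q)
  qed (use assms in \<open>auto simp: lift_def Obj_Q Arr_Q Ide_Q\<close>)
qed

text \<open>Naturality at identities is automatic, so only the edges impose conditions on the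
  components.\<close>

lemma natural_iso_quiver:
  assumes "category D" and F: "is_functor F Q D" and G: "is_functor G Q D"
    and \<eta>: "\<And>v. v \<in> V \<Longrightarrow> \<eta> v \<in> Hom D (omap F v) (omap G v)"
    and iso: "\<And>v. v \<in> V \<Longrightarrow> iso_arr D (\<eta> v)"
    and nat: "\<And>e. e \<in> E \<Longrightarrow> Comp D (\<eta> (t e)) (amap F (Inr e)) = Comp D (amap G (Inr e)) (\<eta> (s e))"
  shows "naturally_isomorphic Q D F G"
proof -
  interpret D: category D by fact
  have "Comp D (\<eta> v) (amap F (Inl v)) = Comp D (amap G (Inl v)) (\<eta> v)" if "v \<in> V" for v
    using that functor_Ide[OF F, of v] functor_Ide[OF G, of v] D.Comp_Ide[OF \<eta>] D.Ide_Comp[OF \<eta>]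
    by (simp add: Obj_Q Ide_Q)
  then show ?thesis
    unfolding naturally_isomorphic_def using \<eta> iso nat
    by (intro exI[of _ \<eta>]) (auto simp: quiver_def)
qed

end

text \<open>\<open>At_source\<close> and \<open>At_target\<close> tag the automorphisms of the
  objects \<open>False\<close> and \<open>True\<close> of a collage; the other kinds tag its arrows
  between these objects, and likewise the edges of the quivers.\<close>

datatype kind = At_source | At_target | Link | Parent | Root

text \<open>\<open>collage U d\<close> has two objects with the same automorphism group \<open>U\<close>, a group of sets under
  symmetric difference.  The arrows from the first to the second object form three copies of \<open>U\<close>
  on which the two copies of \<open>U\<close> act by translation, except that the first automorphism group acts
  on the copy \<open>Parent\<close> through the homomorphism \<open>d\<close> and the second one acts trivially on the copy
  \<open>Root\<close>.\<close>

definition collage :: "'x set set \<Rightarrow> ('x set \<Rightarrow> 'x set) \<Rightarrow> (bool, kind \<times> 'x set) cat" where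
  "collage U d =
     \<lparr>Obj = UNIV,
      Arr = UNIV \<times> U,
      Dom = (\<lambda>(k, S). k = At_target),
      Cod = (\<lambda>(k, S). k \<noteq> At_source),
      Ide = (\<lambda>v. (if v then At_target else At_source, {})),
      Comp = (\<lambda>(k', S') (k, S).
        if k = At_source then (k', sym_diff S' (if k' = Parent then d S else S))
        else (k, sym_diff (if k = Root then {} else S') S))\<rparr>"

text \<open>In terms of sets, \<open>U\<close> is a vector space over the field with two elements
  and \<open>d\<close> a linear operator on it.\<close>

locale translation_group =
  fixes U :: "'x set set" and d :: "'x set \<Rightarrow> 'x set"
  assumes empty: "{} \<in> U" and closed: "S \<in> U \<Longrightarrow> T \<in> U \<Longrightarrow> sym_diff S T \<in> U"
    and d_closed: "S \<in> U \<Longrightarrow> d S \<in> U"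
    and d_hom: "S \<in> U \<Longrightarrow> T \<in> U \<Longrightarrow> d (sym_diff S T) = sym_diff (d S) (d T)"
begin

abbreviation Y where "Y \<equiv> collage U d"

lemma Hom_Y: "x \<in> Hom Y a b \<longleftrightarrow>
    (\<exists>k S. x = (k, S) \<and> S \<in> U \<and> a = (k = At_target) \<and> b = (k \<noteq> At_source))"
  by (cases x) (auto simp: collage_def Hom_iff)

lemma Comp_Y: "Comp Y (k', S') (k, S) =
    (if k = At_source then (k', sym_diff S' (if k' = Parent then d S else S))
     else (k, sym_diff (if k = Root then {} else S') S))"
  by (simp add: collage_def)

lemma Ide_Y: "Ide Y v = (if v then At_target else At_source, {})"
  by (simp add: collage_def)

lemma d_empty: "d {} = {}"
  using d_hom[OF empty empty] by simp

lemma category_collage: "category Y"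
proof
  fix x y z p q r s assume x: "x \<in> Hom Y p q"
  then show "Comp Y x (Ide Y p) = x" "Comp Y (Ide Y q) x = x"
    by (auto simp: Hom_Y Comp_Y Ide_Y d_empty)
  assume y: "y \<in> Hom Y q r"
  show "Comp Y y x \<in> Hom Y p r"
    using x y closed d_closed by (auto simp: Hom_Y Comp_Y)
  assume z: "z \<in> Hom Y r s"
  \<comment> \<open>Additivity of \<open>d\<close> enters when a \<open>Parent\<close> arrow follows
    two automorphisms of its source.\<close>
  show "Comp Y z (Comp Y y x) = Comp Y (Comp Y z y) x"
    using x y z by (auto simp: Hom_Y Comp_Y d_hom split: if_splits)
next
  fix v show "Ide Y v \<in> Hom Y v v" by (auto simp: Hom_Y Ide_Y empty)
qed (auto simp: collage_def)

text \<open>Every set is its own inverse under symmetric difference.\<close>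

lemma iso_arr_Y: "S \<in> U \<Longrightarrow> iso_arr Y (if v then At_target else At_source, S)"
  using category.iso_arr_iff[OF category_collage, of "(if v then At_target else At_source, S)" v v]
  by (auto simp: Hom_Y Comp_Y Ide_Y
      intro!: bexI[of _ "(if v then At_target else At_source, S)"])

end


section \<open>The parent operator on trees of descending sequences\<close>

text \<open>Let \<open>r\<close> be a well-order.  A finite set of elements is a node of a tree, whose parent is obtained by removing the least
  element.  \<open>parent_sum r\<close> is the linear extension of the parent map to finite sets of nodes, regarded
  as vectors over the field with two elements; the root is sent to \<open>0\<close>.\<close>

definition parent_sum :: "'x rel \<Rightarrow> 'x set set \<Rightarrow> 'x set set" where
  "parent_sum r S = {X. odd (card {c. X \<subseteq> {x. c \<in> underS r x} \<and> insert c X \<in> S})}"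

text \<open>Antisymmetry makes the least element \<open>c\<close> of \<open>insert c X\<close>
  unique, so this node has \<open>X\<close> as its only parent.\<close>

lemma parent_sum_singleton:
  assumes "antisym r" "X \<subseteq> {x. c \<in> underS r x}"
  shows "parent_sum r {insert c X} = {X}"
proof -
  have "Z = X \<and> b = c" if Z: "Z \<subseteq> {x. b \<in> underS r x}" "insert b Z = insert c X" for b Z
  proof -
    have "b = c"
    proof (rule ccontr)
      assume "b \<noteq> c"
      then have "b \<in> X" "c \<in> Z" using Z(2) by auto
      then have "(c, b) \<in> r" "(b, c) \<in> r" using assms(2) Z(1) by (auto simp: underS_def)
      then show False using \<open>b \<noteq> c\<close> assms(1) by (auto dest: antisymD)
    qed
    moreover have "b \<notin> Z" "c \<notin> X" using assms(2) Z(1) by (auto simp: underS_def)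
    ultimately show ?thesis using Z(2) by auto
  qed
  then have "{b. Z \<subseteq> {x. b \<in> underS r x} \<and> insert b Z \<in> {insert c X}} = (if Z = X then {c} else {})"
    for Z using assms(2) by auto
  then show ?thesis by (auto simp: parent_sum_def)
qed

text \<open>Odd cardinality excludes an empty set of children. This weaker consequence bounds the
  support of \<open>parent_sum\<close> and drives the comparison of heights.\<close>

lemma mem_parent_sum:
  assumes "X \<in> parent_sum r S"
  obtains c where "X \<subseteq> {x. c \<in> underS r x}" "insert c X \<in> S"
proof -
  define C where "C = {c. X \<subseteq> {x. c \<in> underS r x} \<and> insert c X \<in> S}"
  have "odd (card C)" using assms by (simp add: parent_sum_def C_def)
  then have "C \<noteq> {}" by (metis card.empty even_zero)
  then show ?thesis using that by (auto simp: C_def)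
qed

lemma parent_sum_Fpow:
  assumes "S \<in> Fpow (Fpow B)"
  shows "parent_sum r S \<in> Fpow (Fpow B)"
proof -
  have "parent_sum r S \<subseteq> (\<Union>X\<in>S. Pow X)"
    by (auto elim!: mem_parent_sum)
  moreover have "finite (\<Union>X\<in>S. Pow X)" using assms by (auto simp: Fpow_def)
  moreover have "(\<Union>X\<in>S. Pow X) \<subseteq> Fpow B" using assms by (auto simp: Fpow_def intro: finite_subset)
  ultimately have "parent_sum r S \<subseteq> Fpow B" "finite (parent_sum r S)"
    by (blast, blast intro: finite_subset)
  then show ?thesis by (simp add: Fpow_def[of "Fpow B"])
qed

lemma odd_card_sym_diff:
  assumes "finite A" "finite B"
  shows "odd (card (sym_diff A B)) \<longleftrightarrow> odd (card A) \<noteq> odd (card B)"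
proof -
  have "card A = card (A - B) + card (A \<inter> B)" "card B = card (B - A) + card (A \<inter> B)"
    using assms card_Int_Diff[of A B] card_Int_Diff[of B A] by (simp_all add: Int_commute)
  moreover have "card (sym_diff A B) = card (A - B) + card (B - A)"
    using assms by (intro card_Un_disjoint) auto
  ultimately show ?thesis by auto
qed

lemma parent_sum_sym_diff:
  assumes "finite S" "finite T"
  shows "parent_sum r (sym_diff S T) = sym_diff (parent_sum r S) (parent_sum r T)"
proof -
  let ?C = "\<lambda>S X. {c. X \<subseteq> {x. c \<in> underS r x} \<and> insert c X \<in> S}"
  \<comment> \<open>A child \<open>insert c X\<close> determines \<open>c\<close>, so a finite set
    contains finitely many children of \<open>X\<close>. Parity is additive only for finite sets, as
    \<open>card\<close> is \<open>0\<close> on infinite ones.\<close>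
  have fin: "finite (?C R X)" if "finite R" for R X
  proof (rule finite_imageD)
    show "finite ((\<lambda>c. insert c X) ` ?C R X)" by (rule finite_subset[OF _ that]) auto
    show "inj_on (\<lambda>c. insert c X) (?C R X)"
      by (rule inj_onI) (auto simp: underS_def)
  qed
  have "?C (sym_diff S T) X = sym_diff (?C S X) (?C T X)" for X by auto
  then have "X \<in> parent_sum r (sym_diff S T) \<longleftrightarrow> X \<in> sym_diff (parent_sum r S) (parent_sum r T)" for X
    using odd_card_sym_diff[OF fin[OF assms(1), of X] fin[OF assms(2), of X]]
    by (auto simp: parent_sum_def)
  then show ?thesis by blast
qed

lemma translation_group_parent_sum: "translation_group (Fpow (Fpow B)) (parent_sum r)"
proof
  fix S T :: "'a set set" assume "S \<in> Fpow (Fpow B)" "T \<in> Fpow (Fpow B)"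
  then show "sym_diff S T \<in> Fpow (Fpow B)"
    "parent_sum r (sym_diff S T) = sym_diff (parent_sum r S) (parent_sum r T)"
    using parent_sum_sym_diff by (auto simp: Fpow_def)
next
  fix S :: "'a set set" assume "S \<in> Fpow (Fpow B)"
  then show "parent_sum r S \<in> Fpow (Fpow B)" by (rule parent_sum_Fpow)
qed (simp add: Fpow_def)

text \<open>The counterpart of the fact that a homomorphism of abelian groups does not decrease heights.\<close>

lemma no_tree_labelling:
  assumes wf: "wf (r - Id)"
    and trans: "trans r"
    and \<xi>: "\<And>c X. c \<in> under r a \<Longrightarrow> X \<in> Fpow (under r a) \<Longrightarrow> X \<subseteq> {x. c \<in> underS r x} \<Longrightarrow>
      parent_sum r (\<xi> (insert c X)) = \<xi> X"
    and refl: "(a, a) \<in> r" and root: "\<xi> {} = {{}}" and range: "\<xi> {a} \<subseteq> Fpow (underS r a)"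
  shows False
proof -
  \<comment> \<open>Height comparison by well-founded induction on \<open>c\<close>: a node in the
    label of \<open>insert c X\<close> does not descend below the least element \<open>c\<close> of
    \<open>insert c X\<close>.\<close>
  have bound: "c \<in> under r a \<Longrightarrow> X \<in> Fpow (under r a) \<Longrightarrow> X \<subseteq> {x. c \<in> underS r x} \<Longrightarrow>
      Q \<in> \<xi> (insert c X) \<Longrightarrow> x \<in> Q \<Longrightarrow> x \<notin> underS r c" for c X Q x
    using wf
  proof (induction c arbitrary: X Q x rule: wf_induct_rule)
    case (less c)
    show ?case
    proof
      assume x: "x \<in> underS r c"
      let ?X = "insert c X"
      have xa: "x \<in> under r a"
        using x less.prems(1) trans by (auto simp: under_def underS_def dest: transD)
      have xX: "?X \<subseteq> {y. x \<in> underS r y}"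
        using x less.prems(3) trans wf_not_sym[OF wf]
        by (fastforce simp: underS_def dest: transD)
      have "?X \<in> Fpow (under r a)" using less.prems by (auto simp: Fpow_def)
      then have "parent_sum r (\<xi> (insert x ?X)) = \<xi> ?X" using \<xi>[OF xa _ xX] by blast
      \<comment> \<open>The label of the child \<open>insert x ?X\<close> contains a child
        \<open>insert b Q\<close> of \<open>Q\<close>. As \<open>x\<close> is in \<open>Q\<close>,
        its element \<open>b\<close> lies below \<open>x\<close>, against the induction hypothesis
        for \<open>x\<close>.\<close>
      then obtain b where b: "Q \<subseteq> {y. b \<in> underS r y}" "insert b Q \<in> \<xi> (insert x ?X)"
        using less.prems(4) mem_parent_sum by metis
      have "b \<notin> underS r x"
        using less.IH[OF _ xa \<open>?X \<in> Fpow (under r a)\<close> xX b(2)] x by (auto simp: underS_def)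
      moreover have "b \<in> underS r x" using b(1) less.prems(5) by auto
      ultimately show False by blast
    qed
  qed
  have a: "a \<in> under r a" "({} :: 'a set) \<in> Fpow (under r a)"
    using refl by (auto simp: under_def Fpow_def)
  \<comment> \<open>Labels of \<open>{a}\<close> involve only elements below \<open>a\<close>, and
    the bound for \<open>c = a\<close> excludes these, so at most the root occurs. But a sum of
    parents equal to \<open>{{}}\<close> requires a child of the root.\<close>
  have "Q = {}" if "Q \<in> \<xi> {a}" for Q
    using bound[OF a _ that] range that by (auto simp: Fpow_def)
  moreover have "{} \<in> parent_sum r (\<xi> {a})" using \<xi>[OF a] root by simp
  ultimately show False by (elim mem_parent_sum) blast
qed

section \<open>The tree, label and collage categories and the functors between them\<close>

definition tree_edges :: "'x rel \<Rightarrow> 'x set set \<Rightarrow> (kind \<times> 'x set \<times> 'x set) set" where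
  "tree_edges r N = {(Link, X, X) | X. X \<in> N} \<union>
     {(Parent, insert c X, X) | c X. insert c X \<in> N \<and> X \<in> N \<and> X \<subseteq> {x. c \<in> underS r x}} \<union>
     {(Root, {}, {})}"

text \<open>These are the categories Z of the introduction; \<open>label_quiver\<close> and
  \<open>tree_collage\<close> are A and Y. Doubling each node into a \<open>False\<close> and a
  \<open>True\<close> vertex keeps the edges from being composable.\<close>

abbreviation tree_quiver :: "'x rel \<Rightarrow> 'x set \<Rightarrow>
    ('x set \<times> bool, 'x set \<times> bool + kind \<times> 'x set \<times> 'x set) cat" where
  "tree_quiver r B \<equiv> quiver (Fpow B \<times> UNIV) (tree_edges r (Fpow B))
     (\<lambda>(k, X, X'). (X, False)) (\<lambda>(k, X, X'). (X', True))"

abbreviation labels :: "(kind \<times> bool) set" where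
  "labels \<equiv> {Link, Parent, Root} \<times> UNIV"

abbreviation label_quiver :: "(bool, bool + kind \<times> bool) cat" where
  "label_quiver \<equiv> quiver UNIV labels (\<lambda>_. False) (\<lambda>_. True)"

abbreviation tree_collage :: "'x rel \<Rightarrow> 'x set \<Rightarrow> (bool, kind \<times> 'x set set) cat" where
  "tree_collage r B \<equiv> collage (Fpow (Fpow B)) (parent_sum r)"

interpretation label: bipartite_quiver UNIV labels "\<lambda>_. False" "\<lambda>_. True"
  by unfold_locales auto

interpretation tree: bipartite_quiver "Fpow B \<times> UNIV" "tree_edges r (Fpow B)"
    "\<lambda>(k, X, X'). (X, False)" "\<lambda>(k, X, X'). (X', True)" for r B
  by unfold_locales (auto simp: tree_edges_def empty_in_Fpow)

interpretation tree_collage: translation_group "Fpow (Fpow B)" "parent_sum r" for r B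
  by (rule translation_group_parent_sum)

text \<open>The parallel pair u, v of the introduction: its members differ only in the flag at the
  \<open>Root\<close> edge.\<close>

definition tree_labelling :: "'x rel \<Rightarrow> 'x set \<Rightarrow> bool \<Rightarrow>
    ('x set \<times> bool, 'x set \<times> bool + kind \<times> 'x set \<times> 'x set, bool, bool + kind \<times> bool) funct" where
  "tree_labelling r B m = tree.lift B r label_quiver snd (\<lambda>(k, X, X'). Inr (k, m \<and> k = Root))"

text \<open>As vectors, \<open>{{}}\<close> is the root of the tree and \<open>{}\<close> is
  zero.\<close>

definition label_collage :: "'x rel \<Rightarrow> 'x set \<Rightarrow> (bool, bool + kind \<times> bool, bool, kind \<times> 'x set set) funct" where
  "label_collage r B =
     label.lift (tree_collage r B) (\<lambda>v. v) (\<lambda>(k, m). (k, if m then {{}} else {}))"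

lemma is_functor_tree_labelling: "is_functor (tree_labelling r B m) (tree_quiver r B) label_quiver"
  unfolding tree_labelling_def
  by (rule tree.is_functor_lift[OF label.category_quiver])
    (auto simp: label.Obj_Q label.Hom_Q tree_edges_def)

lemma is_functor_label_collage: "is_functor (label_collage r B) label_quiver (tree_collage r B)"
  unfolding label_collage_def
  by (rule label.is_functor_lift[OF tree_collage.category_collage])
    (auto simp: collage_def Hom_iff Fpow_def split: if_splits)

abbreviation tree_map where
  "tree_map r B B' m \<equiv>
    comp_functor (tree_quiver r B) (label_collage r B') (tree_labelling r B m)"

lemma is_functor_tree_map: "is_functor (tree_map r B B' m) (tree_quiver r B) (tree_collage r B')"
  by (rule category.is_functor_comp[OF tree.category_quiver is_functor_tree_labelling
        is_functor_label_collage])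

lemma omap_tree_map: "X \<in> Fpow B \<Longrightarrow> omap (tree_map r B B' m) (X, v) = v"
  by (simp add: tree.Obj_Q tree_labelling_def label_collage_def)

lemma amap_tree_map:
  assumes "(k, X, X') \<in> tree_edges r (Fpow B)"
  shows "amap (tree_map r B B' m) (Inr (k, X, X')) = (k, if m \<and> k = Root then {{}} else {})"
proof -
  have "(k, n) \<in> labels" for n using assms by (auto simp: tree_edges_def)
  moreover have "Inr (k, X, X') \<in> Arr (tree_quiver r B)" using assms by (simp add: tree.Arr_Q InrI)
  ultimately show ?thesis
    using assms by (simp add: tree_labelling_def label_collage_def)
qed

text \<open>Labelling each node \<open>X\<close> by the basis vector \<open>{X}\<close> solves all
  equations. It is available since nodes over \<open>B\<close> are nodes over \<open>B'\<close>, and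
  \<open>parent_sum_singleton\<close> settles the \<open>Parent\<close> edges.\<close>

lemma natural_iso_tree_map:
  assumes "antisym r" "B \<subseteq> B'"
  shows "naturally_isomorphic (tree_quiver r B) (tree_collage r B') (tree_map r B B' False)
    (tree_map r B B' True)"
proof (rule tree.natural_iso_quiver[OF tree_collage.category_collage is_functor_tree_map
      is_functor_tree_map, where \<eta> = "\<lambda>(X, v). (if v then At_target else At_source, {X})"])
  have *: "{X} \<in> Fpow (Fpow B')" if "X \<in> Fpow B" for X
    using that assms(2) by (auto simp: Fpow_def)
  fix v assume v: "v \<in> Fpow B \<times> (UNIV :: bool set)"
  then show "(case v of (X, v) \<Rightarrow> (if v then At_target else At_source, {X}))
    \<in> Hom (tree_collage r B') (omap (tree_map r B B' False) v) (omap (tree_map r B B' True) v)"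
    using * by (auto simp: omap_tree_map tree_collage.Hom_Y)
  show "iso_arr (tree_collage r B') (case v of (X, v) \<Rightarrow> (if v then At_target else At_source, {X}))"
    using v * tree_collage.iso_arr_Y[of _ B' r "snd v"] by (cases v) auto
next
  fix e assume e: "e \<in> tree_edges r (Fpow B)"
  obtain k X X' where kX: "e = (k, X, X')" by (cases e) auto
  have "k = Link \<and> X = X' \<or> (\<exists>c. k = Parent \<and> X = insert c X' \<and> X' \<subseteq> {x. c \<in> underS r x}) \<or>
      k = Root \<and> X = {} \<and> X' = {}"
    using e kX by (auto simp: tree_edges_def)
  then show "Comp (tree_collage r B')
      (case (case e of (k, X, X') \<Rightarrow> (X', True)) of (X, v) \<Rightarrow> (if v then At_target else At_source, {X}))
      (amap (tree_map r B B' False) (Inr e)) =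
    Comp (tree_collage r B') (amap (tree_map r B B' True) (Inr e))
      (case (case e of (k, X, X') \<Rightarrow> (X, False)) of (X, v) \<Rightarrow> (if v then At_target else At_source, {X}))"
    using e unfolding kX
    by (auto simp: amap_tree_map tree_collage.Comp_Y parent_sum_singleton[OF assms(1)])
qed

text \<open>The components of an isomorphism at the \<open>False\<close> vertices would form a
  labelling that \<open>no_tree_labelling\<close> forbids: the source tree contains
  \<open>a\<close>, while the labels use only elements below \<open>a\<close>.\<close>

lemma not_natural_iso_tree_map:
  assumes r: "well_order_on UNIV r"
  shows "\<not> naturally_isomorphic (tree_quiver r (under r a)) (tree_collage r (underS r a))
    (tree_map r (under r a) (underS r a) False) (tree_map r (under r a) (underS r a) True)"
proof
  let ?B = "under r a" and ?B' = "underS r a"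
  let ?Q = "tree_quiver r ?B" and ?Y = "tree_collage r ?B'"
  assume "naturally_isomorphic ?Q ?Y (tree_map r ?B ?B' False) (tree_map r ?B ?B' True)"
  then obtain \<eta> where \<eta>': "\<And>x. x \<in> Obj ?Q \<Longrightarrow>
      \<eta> x \<in> Hom ?Y (omap (tree_map r ?B ?B' False) x) (omap (tree_map r ?B ?B' True) x)"
    and nat': "\<And>f. f \<in> Arr ?Q \<Longrightarrow> Comp ?Y (\<eta> (Cod ?Q f)) (amap (tree_map r ?B ?B' False) f)
      = Comp ?Y (amap (tree_map r ?B ?B' True) f) (\<eta> (Dom ?Q f))"
    unfolding naturally_isomorphic_def by blast
  have \<eta>: "\<eta> (X, v) \<in> Hom ?Y v v" if "X \<in> Fpow ?B" for X v
    using \<eta>'[of "(X, v)"] that by (simp only: omap_tree_map tree.Obj_Q) simp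
  have nat: "Comp ?Y (\<eta> (X', True)) (k, {}) = Comp ?Y (k, if k = Root then {{}} else {}) (\<eta> (X, False))"
    if e: "(k, X, X') \<in> tree_edges r (Fpow ?B)" for k X X'
  proof -
    have "Dom ?Q (Inr (k, X, X')) = (X, False)" "Cod ?Q (Inr (k, X, X')) = (X', True)"
      using tree.Inr_Hom[OF e] by (simp_all add: Hom_iff)
    moreover have "Inr (k, X, X') \<in> Arr ?Q" using e by (simp add: tree.Arr_Q InrI)
    ultimately show ?thesis using nat'[of "Inr (k, X, X')"] by (simp add: amap_tree_map[OF e])
  qed
  define \<xi> where "\<xi> X = snd (\<eta> (X, False))" for X
  define \<zeta> where "\<zeta> X = snd (\<eta> (X, True))" for X
  have \<eta>_eq: "\<eta> (X, False) = (At_source, \<xi> X)" "\<eta> (X, True) = (At_target, \<zeta> X)"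
    and \<xi>: "\<xi> X \<in> Fpow (Fpow ?B')" if "X \<in> Fpow ?B" for X
    using \<eta>[OF that, of False] \<eta>[OF that, of True] by (auto simp: tree_collage.Hom_Y \<xi>_def \<zeta>_def)
  \<comment> \<open>Naturality at a \<open>Link\<close> edge equates both components at a node, so
    that the \<open>Parent\<close> equations involve \<open>\<xi>\<close> alone.\<close>
  have link: "\<zeta> X = \<xi> X" if "X \<in> Fpow ?B" for X
    using nat[of Link X X] that by (auto simp: tree_edges_def \<eta>_eq tree_collage.Comp_Y)
  have parent: "parent_sum r (\<xi> (insert c X)) = \<xi> X"
    if "c \<in> ?B" "X \<in> Fpow ?B" "X \<subseteq> {x. c \<in> underS r x}" for c X
  proof -
    have "insert c X \<in> Fpow ?B" using that by (auto simp: Fpow_def)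
    moreover from this have "(Parent, insert c X, X) \<in> tree_edges r (Fpow ?B)"
      using that by (auto simp: tree_edges_def)
    ultimately show ?thesis
      using nat[of Parent "insert c X" X] that(2) link[OF that(2)]
      by (simp add: \<eta>_eq tree_collage.Comp_Y)
  qed
  have root: "\<xi> {} = {{}}"
  proof -
    \<comment> \<open>The target group acts trivially on \<open>Root\<close> arrows, so naturality
      there fixes the label of the root itself.\<close>
    have "{} = sym_diff {{}} (\<xi> {})"
      using nat[of Root "{}" "{}"] by (simp add: tree_edges_def empty_in_Fpow \<eta>_eq tree_collage.Comp_Y)
    then show ?thesis by blast
  qed
  have "wf (r - Id)" "trans r" "(a, a) \<in> r"
    using r by (auto simp: well_order_on_def linear_order_on_def partial_order_on_def
        preorder_on_def refl_on_def)
  moreover from \<open>(a, a) \<in> r\<close> have "\<xi> {a} \<subseteq> Fpow ?B'"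
    using \<xi>[of "{a}"] by (auto simp: Fpow_def under_def)
  ultimately show False using no_tree_labelling[of r a \<xi>] parent root by blast
qed

section \<open>A cardinality obstruction to faithful functors into sets\<close>

text \<open>If \<open>F\<close> is faithful, then for each \<open>i\<close> some point of \<open>F (z i)\<close> has two images in \<open>F a\<close> that
  \<open>F (g i)\<close> separates.  Different \<open>i\<close> yield different pairs of points of \<open>F a\<close>.\<close>

lemma faithful_Set_cat_obstruction:
  fixes F :: "('o, 'a, 'u set, 'u set \<times> ('u \<Rightarrow> 'u) \<times> 'u set) funct"
    and z y :: "'u \<Rightarrow> 'o" and u v g :: "'u \<Rightarrow> 'a"
  assumes inf: "infinite (UNIV :: 'u set)"
    and F: "is_functor F C Set_cat" and faithful: "faithful F C"
    and ob: "a \<in> Obj C" "\<And>i. z i \<in> Obj C" "\<And>i. y i \<in> Obj C"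
    and u: "\<And>i. u i \<in> Hom C (z i) a" and v: "\<And>i. v i \<in> Hom C (z i) a"
    and g: "\<And>i. g i \<in> Hom C a (y i)"
    and gu: "\<And>i. Comp C (g i) (u i) \<in> Hom C (z i) (y i)"
    and gv: "\<And>i. Comp C (g i) (v i) \<in> Hom C (z i) (y i)"
    and neq: "\<And>i. Comp C (g i) (u i) \<noteq> Comp C (g i) (v i)"
    and eq: "\<And>i j. i \<noteq> j \<Longrightarrow> Comp C (g i) (u j) = Comp C (g i) (v j) \<or>
      Comp C (g j) (u i) = Comp C (g j) (v i)"
  shows False
proof -
  define fn where "fn f = fst (snd (amap F f))" for f
  have arr: "amap F f = (omap F b, fn f, omap F c)" "fn f \<in> omap F b \<rightarrow>\<^sub>E omap F c"
    if "f \<in> Hom C b c" for f b c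
    using functor_Hom[OF F that] by (auto simp: Set_cat_def Hom_iff fn_def)
  have comp: "amap F (Comp C k f) = (omap F b, compose (omap F b) (fn k) (fn f), omap F d)"
    if "f \<in> Hom C b c" "k \<in> Hom C c d" for f k b c d
    using functor_Comp[OF F that] arr(1)[OF that(1)] arr(1)[OF that(2)] by (simp add: Set_cat_def)
  have "\<exists>x\<in>omap F (z i). fn (g i) (fn (u i) x) \<noteq> fn (g i) (fn (v i) x)" for i
  proof (rule ccontr)
    assume "\<not> ?thesis"
    then have "compose (omap F (z i)) (fn (g i)) (fn (u i)) = compose (omap F (z i)) (fn (g i)) (fn (v i))"
      by (auto simp: compose_def restrict_def)
    then have "amap F (Comp C (g i) (u i)) = amap F (Comp C (g i) (v i))"
      using comp[OF u g] comp[OF v g] by simp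
    then show False
      using faithful gu gv neq ob unfolding faithful_def by (meson inj_onD)
  qed
  then obtain x where x: "\<And>i. x i \<in> omap F (z i)"
    "\<And>i. fn (g i) (fn (u i) (x i)) \<noteq> fn (g i) (fn (v i) (x i))"
    by metis
  define P where "P i = (fn (u i) (x i), fn (v i) (x i))" for i
  \<comment> \<open>\<open>F (g i)\<close> merges the coordinates of \<open>P j\<close> but
    separates those of \<open>P i\<close>.\<close>
  have separate: "P i \<noteq> P j" if "Comp C (g i) (u j) = Comp C (g i) (v j)" for i j
  proof
    assume "P i = P j"
    have "compose (omap F (z j)) (fn (g i)) (fn (u j)) = compose (omap F (z j)) (fn (g i)) (fn (v j))"
      using that comp[OF u g, of i j] comp[OF v g, of i j] by simp
    then have "fn (g i) (fn (u j) (x j)) = fn (g i) (fn (v j) (x j))"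
      using x(1) by (metis compose_eq)
    then show False using x(2)[of i] \<open>P i = P j\<close> by (simp add: P_def)
  qed
  \<comment> \<open>Either alternative of \<open>eq\<close> suffices, as distinctness is
    symmetric.\<close>
  then have "inj P" using eq by (metis injI)
  moreover have "range P \<subseteq> omap F a \<times> omap F a"
    using PiE_mem[OF arr(2)[OF u] x(1)] PiE_mem[OF arr(2)[OF v] x(1)] by (auto simp: P_def)
  ultimately have "(UNIV :: 'u set) \<lesssim> omap F a \<times> omap F a"
    unfolding lepoll_def by blast
  moreover have "omap F a \<prec> (UNIV :: 'u set)"
    using functor_omap[OF F ob(1)] by (simp add: Set_cat_def small_def)
  then have "omap F a \<times> omap F a \<prec> (UNIV :: 'u set)"
    using Times_lesspoll_infinite[OF inf] by blast
  ultimately show False using lepoll_antisym unfolding lesspoll_def by blast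
qed

section \<open>Transport of functors to small copies\<close>

definition conjugate :: "('u, 'u) cat \<Rightarrow> ('p, 'b, 'u, 'u) funct \<Rightarrow> ('o, 'a, 'p, 'b) funct \<Rightarrow>
    ('u, 'u, 'o, 'a) funct \<Rightarrow> ('u, 'u, 'u, 'u) funct" where
  "conjugate S E F D = comp_functor S E (comp_functor S F D)"

lemma is_functor_conjugate:
  assumes "small_copy C S E D" "small_copy C' S' E' D'" "is_functor F C C'"
  shows "is_functor (conjugate S E' F D) S S'"
proof -
  interpret S: category S using assms(1) by (simp add: small_copy_def small_categoryD)
  have "is_functor D S C" "is_functor E' C' S'" using assms by (auto simp: small_copy_def)
  then show ?thesis
    unfolding conjugate_def by (intro S.is_functor_comp[OF S.is_functor_comp[OF _ assms(3)]])
qed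

text \<open>In the middle, \<open>D'\<close> after \<open>E'\<close> is an identity and drops
  out.\<close>

lemma comp_conjugate:
  assumes 1: "small_copy C S E D" and 2: "small_copy C' S' E' D'"
    and F: "is_functor F C C'"
  shows "comp_functor S (conjugate S' E'' G D') (conjugate S E' F D)
    = conjugate S E'' (comp_functor C G F) D"
proof -
  interpret S: category S using 1 by (simp add: small_copy_def small_categoryD)
  have D: "is_functor D S C" and E': "is_functor E' C' S'" and D': "is_functor D' S' C'"
    and D'E': "comp_functor C' D' E' = id_functor C'"
    using 1 2 by (auto simp: small_copy_def)
  note FD = S.is_functor_comp[OF D F]
  note K = S.is_functor_comp[OF FD E']
  have "comp_functor S D' (comp_functor S E' (comp_functor S F D)) = comp_functor S F D"
    by (simp add: S.comp_functor_assoc[OF FD] D'E' S.comp_id_functor[OF FD])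
  then have "comp_functor S (comp_functor S' G D') (comp_functor S E' (comp_functor S F D))
      = comp_functor S (comp_functor C G F) D"
    unfolding S.comp_functor_assoc[OF K, symmetric] by (simp add: S.comp_functor_assoc[OF D])
  then show ?thesis
    unfolding conjugate_def S.comp_functor_assoc[OF K, symmetric] by simp
qed

text \<open>One direction is whiskering; in the other, composition with \<open>D'\<close> and
  \<open>E\<close> undoes the conjugation strictly.\<close>

lemma natural_iso_conjugate_iff:
  assumes C: "category C" "category C'" and 1: "small_copy C S E D" and 2: "small_copy C' S' E' D'"
    and F: "is_functor F C C'" and G: "is_functor G C C'"
  shows "naturally_isomorphic S S' (conjugate S E' F D) (conjugate S E' G D)
    \<longleftrightarrow> naturally_isomorphic C C' F G"
proof
  interpret S: category S using 1 by (simp add: small_copy_def small_categoryD)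
  interpret S': category S' using 2 by (simp add: small_copy_def small_categoryD)
  interpret C: category C by fact
  have D: "is_functor D S C" and E: "is_functor E C S" and DE: "comp_functor C D E = id_functor C"
    and E': "is_functor E' C' S'" and D': "is_functor D' S' C'"
    and D'E': "comp_functor C' D' E' = id_functor C'"
    using 1 2 by (auto simp: small_copy_def)
  show "naturally_isomorphic S S' (conjugate S E' F D) (conjugate S E' G D)"
    if "naturally_isomorphic C C' F G"
    unfolding conjugate_def
    by (intro natural_iso_whisker_left[OF S.category_axioms C(2) S'.category_axioms]
        natural_iso_whisker_right[OF S.category_axioms F G D that] S.is_functor_comp[OF D] F G E')
  assume *: "naturally_isomorphic S S' (conjugate S E' F D) (conjugate S E' G D)"
  have FG: "is_functor (conjugate S E' F D) S S'" "is_functor (conjugate S E' G D) S S'"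
    by (rule is_functor_conjugate[OF 1 2 F], rule is_functor_conjugate[OF 1 2 G])
  have unconjugate: "comp_functor C (comp_functor S D' (conjugate S E' H D)) E = H"
    if H: "is_functor H C C'" for H
  proof -
    note HD = S.is_functor_comp[OF D H]
    have "comp_functor S D' (conjugate S E' H D) = comp_functor S H D"
      by (simp add: conjugate_def S.comp_functor_assoc[OF HD] D'E' S.comp_id_functor[OF HD])
    then show ?thesis
      by (simp add: C.comp_functor_assoc[OF E, symmetric] DE C.comp_functor_id[OF H])
  qed
  have "naturally_isomorphic C C' (comp_functor C (comp_functor S D' (conjugate S E' F D)) E)
      (comp_functor C (comp_functor S D' (conjugate S E' G D)) E)"
    by (intro natural_iso_whisker_right[OF C(1) _ _ E] S.is_functor_comp[OF _ D'] FG
        natural_iso_whisker_left[OF S.category_axioms S'.category_axioms C(2) FG D' *])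
  then show "naturally_isomorphic C C' F G" by (simp add: unconjugate F G)
qed

section \<open>Non-concreteness of the homotopy category\<close>

theorem corollary6p3:
  assumes "infinite (UNIV :: 'u set)"
  shows "\<not> concrete TYPE('u) (ho (folk_Cat TYPE('u)))"
proof
  note inf = assms
  let ?M = "folk_Cat TYPE('u)"
  assume "concrete TYPE('u) (ho ?M)"
  then obtain F :: "(('u, 'u) cat, ('u, 'u) cat \<times> 'u cat_arr step list set \<times> ('u, 'u) cat,
      'u set, 'u set \<times> ('u \<Rightarrow> 'u) \<times> 'u set) funct"
    where F: "is_functor F (localization ?M equivalences) Set_cat"
      "faithful F (localization ?M equivalences)"
    unfolding concrete_def ho_def folk_Cat_simps by blast
  \<comment> \<open>In the cardinal order of \<open>'u\<close> proper initial segments are small,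
    and so are the trees and vector spaces over them.\<close>
  define r where "r = |UNIV :: 'u set|"
  have r: "well_order_on UNIV r" by (simp add: r_def card_of_well_order_on)
  then have r': "antisym r" "trans r" "total r"
    by (auto simp: well_order_on_def linear_order_on_def partial_order_on_def preorder_on_def)
  have finite: "X \<prec> (UNIV :: 'u set)" if "finite X" for X :: "'b set"
    using that inf by (simp add: finite_lesspoll_infinite)
  have UNIV_kind: "(UNIV :: kind set) = {At_source, At_target, Link, Parent, Root}"
    using kind.nchotomy by auto
  have kind: "(UNIV :: kind set) \<prec> (UNIV :: 'u set)" by (rule finite) (simp add: UNIV_kind)
  note prod = Times_lesspoll_infinite[OF inf] and Fpow = Fpow_lesspoll_infinite[OF inf]
  have underS: "underS r i \<prec> (UNIV :: 'u set)" for i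
    unfolding lesspoll_iff_ordLess r_def
    by (rule card_of_underS) (simp_all add: card_of_card_order_on Field_card_of)
  have under: "under r i \<prec> (UNIV :: 'u set)" for i
  proof (rule lesspoll_trans1)
    show "under r i \<lesssim> {i} \<union> underS r i"
      by (rule subset_imp_lepoll) (auto simp: under_def underS_def)
    show "{i} \<union> underS r i \<prec> (UNIV :: 'u set)"
      by (intro Un_lesspoll_infinite[OF inf] underS finite) simp
  qed
  \<comment> \<open>One finite category \<open>A\<close> serves all indices, so all pairs of points
    lie in the square of a single small set.\<close>
  have "\<exists>S E D. small_copy label_quiver (S :: ('u, 'u) cat) E D"
    by (rule ex_small_copy[OF label.category_quiver]; rule finite)
      (simp_all add: label.Obj_Q label.Arr_Q)
  then obtain A :: "('u, 'u) cat" and EA DA where A: "small_copy label_quiver A EA DA"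
    by blast
  have "\<exists>S E D. small_copy (tree_quiver r (under r i)) (S :: ('u, 'u) cat) E D" for i
  proof -
    let ?N = "Fpow (under r i)"
    have N: "?N \<prec> (UNIV :: 'u set)" by (rule Fpow[OF under])
    have ob: "?N \<times> (UNIV :: bool set) \<prec> (UNIV :: 'u set)" by (intro prod N finite) simp
    have "tree_edges r ?N \<lesssim> (UNIV :: kind set) \<times> ?N \<times> ?N"
      by (rule subset_imp_lepoll) (auto simp: tree_edges_def empty_in_Fpow)
    then have "tree_edges r ?N \<prec> (UNIV :: 'u set)"
      by (rule lesspoll_trans1) (intro prod N kind)
    then have "Arr (tree_quiver r (under r i)) \<prec> (UNIV :: 'u set)"
      unfolding tree.Arr_Q by (intro Plus_lesspoll_infinite[OF inf] ob)
    moreover have "Obj (tree_quiver r (under r i)) \<prec> (UNIV :: 'u set)"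
      unfolding tree.Obj_Q by (rule ob)
    ultimately show ?thesis by (intro ex_small_copy[OF tree.category_quiver])
  qed
  then obtain Z :: "'u \<Rightarrow> ('u, 'u) cat" and EZ DZ
    where Z: "\<And>i. small_copy (tree_quiver r (under r i)) (Z i) (EZ i) (DZ i)" by metis
  have "\<exists>S E D. small_copy (tree_collage r (underS r i)) (S :: ('u, 'u) cat) E D" for i
  proof -
    have "Obj (tree_collage r (underS r i)) \<prec> (UNIV :: 'u set)"
      by (rule finite) (simp add: collage_def)
    moreover have "Arr (tree_collage r (underS r i)) \<prec> (UNIV :: 'u set)"
      using prod[OF kind Fpow[OF Fpow[OF underS]]] by (simp add: collage_def)
    ultimately show ?thesis by (rule ex_small_copy[OF tree_collage.category_collage])
  qed
  then obtain Y :: "'u \<Rightarrow> ('u, 'u) cat" and EY DY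
    where Y: "\<And>i. small_copy (tree_collage r (underS r i)) (Y i) (EY i) (DY i)" by metis
  \<comment> \<open>\<open>t False i\<close> and \<open>t True i\<close> are the parallel pair,
    \<open>g j\<close> is the functor that tests it, all moved to small copies.\<close>
  define t where "t m i = conjugate (Z i) EA (tree_labelling r (under r i) m) (DZ i)" for m i
  define g where "g i = conjugate A (EY i) (label_collage r (underS r i)) DA" for i
  have small: "small_category A" "\<And>i. small_category (Z i)" "\<And>i. small_category (Y i)"
    using A Y Z by (auto simp: small_copy_def)
  have t: "is_functor (t m i) (Z i) A" for m i
    unfolding t_def by (rule is_functor_conjugate[OF Z A is_functor_tree_labelling])
  have g: "is_functor (g i) A (Y i)" for i
    unfolding g_def by (rule is_functor_conjugate[OF A Y is_functor_label_collage])
  have gt: "is_functor (comp_functor (Z i) (g j) (t m i)) (Z i) (Y j)" for i j m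
    by (rule category.is_functor_comp[OF small_categoryD[OF small(2)] t g])
  have iso_iff: "naturally_isomorphic (Z i) (Y j) (comp_functor (Z i) (g j) (t False i))
      (comp_functor (Z i) (g j) (t True i)) \<longleftrightarrow>
    naturally_isomorphic (tree_quiver r (under r i)) (tree_collage r (underS r j))
      (tree_map r (under r i) (underS r j) False) (tree_map r (under r i) (underS r j) True)" for i j
    unfolding g_def t_def
      comp_conjugate[OF Z A is_functor_tree_labelling]
    by (rule natural_iso_conjugate_iff[OF tree.category_quiver tree_collage.category_collage Z Y
          is_functor_tree_map is_functor_tree_map])
  interpret M: category ?M by (rule category_folk_Cat)
  let ?L = "loc_arr ?M equivalences" and ?H = "localization ?M equivalences"
  define t' where "t' m i = ?L (Z i, t m i, A)" for m i
  define g' where "g' i = ?L (A, g i, Y i)" for i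
  have hom: "(Z i, t m i, A) \<in> Hom ?M (Z i) A" "(A, g i, Y i) \<in> Hom ?M A (Y i)" for m i
    using small t g by (auto simp: Hom_Cat)
  have comp: "Comp ?H (g' j) (t' m i) = ?L (Z i, comp_functor (Z i) (g j) (t m i), Y j)" for i j m
    unfolding t'_def g'_def using M.loc_arr_Comp[OF hom] by (simp add: Comp_Cat)
  \<comment> \<open>Equality in the homotopy category is natural isomorphism of functors, which
    conjugation to small copies preserves and reflects.\<close>
  have comp_iff: "Comp ?H (g' j) (t' False i) = Comp ?H (g' j) (t' True i) \<longleftrightarrow>
    naturally_isomorphic (tree_quiver r (under r i)) (tree_collage r (underS r j))
      (tree_map r (under r i) (underS r j) False) (tree_map r (under r i) (underS r j) True)" for i j
    unfolding comp iso_iff[symmetric]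
    using natural_iso_of_loc_arr_eq[OF small(2,3) gt gt]
      loc_arr_eq_of_natural_iso[OF inf small(2,3) gt gt] by blast
  have Obj_H: "Obj ?H = {C. small_category C}" by (auto simp: localization_def Obj_Cat)
  have hom_H: "t' m i \<in> Hom ?H (Z i) A" "g' i \<in> Hom ?H A (Y i)"
    "Comp ?H (g' i) (t' m i) \<in> Hom ?H (Z i) (Y i)" for m i
    unfolding comp unfolding t'_def g'_def by (intro M.loc_arr_Hom; simp add: Hom_Cat small t g gt)+
  show False
  proof (rule faithful_Set_cat_obstruction[OF inf F, where z = Z and y = Y and a = A and
        u = "t' False" and v = "t' True" and g = g'])
    show "Comp ?H (g' i) (t' False i) \<noteq> Comp ?H (g' i) (t' True i)" for i
      unfolding comp_iff by (rule not_natural_iso_tree_map[OF r])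
    show "Comp ?H (g' i) (t' False j) = Comp ?H (g' i) (t' True j) \<or>
      Comp ?H (g' j) (t' False i) = Comp ?H (g' j) (t' True i)" if "i \<noteq> j" for i j
    proof -
      \<comment> \<open>For \<open>i\<close> strictly below \<open>j\<close> the closed segment of
        \<open>i\<close> fits into the open segment of \<open>j\<close>; for equal indices it
        exceeds it by one element.\<close>
      have *: "under r i \<subseteq> underS r j" if "(i, j) \<in> r" "i \<noteq> j" for i j
        using that r'(1,2) unfolding under_def underS_def by (auto dest: transD antisymD)
      have "(i, j) \<in> r \<or> (j, i) \<in> r" using r'(3) that by (auto simp: total_on_def)
      then have "under r i \<subseteq> underS r j \<or> under r j \<subseteq> underS r i"
        using * that by blast
      then show ?thesis unfolding comp_iff using natural_iso_tree_map[OF r'(1)] by blast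
    qed
  qed (simp_all add: Obj_H small hom_H)
qed

end
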